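(* Let $\omega=e^{-2\varphi}\in\mathcal{W}$ with associated function $\tau$, let $\phi:\mathbb{D}\to\mathbb{D}$ be analytic, and let $g\in H(\mathbb{D})$. (A) If $0<p,q<\infty$ and $GI_{(\phi,g)}:A^p_\omega\to A^q_\omega$ is bounded, then the function $$z\mapsto|g(z)|\,\frac{\tau(z)^{2/q}}{\tau(\phi(z))^{2/p}}\,\frac{1+\varphi'(\phi(z))}{1+\varphi'(z)}\,\frac{\omega(z)^{1/2}}{\omega(\phi(z))^{1/2}}$$ belongs to $L^\infty(\mathbb{D},dA)$; and if $GI_{(\phi,g)}:A^p_\omega\to A^q_\omega$ is compact, then this function tends to $0$ as $|z|\to1$. (B) If $0<p\le q<\infty$ and $GV_{(\phi,g)}:A^p_\omega\to A^q_\omega$ is bounded, then the function $$z\mapsto\frac{\tau(z)^{2/q}}{\tau(\phi(z))^{2/p}}\,\frac{|g(z)|}{1+\varphi'(z)}\,\frac{\omega(z)^{1/2}}{\omega(\phi(z))^{1/2}}$$ belongs to $L^\infty(\mathbb{D},dA)$; and if $GV_{(\phi,g)}:A^p_\omega\to A^q_\omega$ is compact, then this function tends to $0$ as $|\phi(z)|\to1$.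
   Context: $\mathbb{D}$ is the open unit disk in $\mathbb{C}$, $H(\mathbb{D})$ the space of analytic functions on $\mathbb{D}$, $dA$ normalized area measure on $\mathbb{D}$, and $\Delta$ the standard Laplace operator. $a\asymp b$ means that each quantity is bounded by a constant multiple of the other. Class $\mathcal{W}$: it consists of the radial decreasing weights $\omega(z)=e^{-2\varphi(z)}$ on $\mathbb{D}$, where $\varphi\in C^2(\mathbb{D})$ is radial and $(\Delta\varphi(z))^{-1/2}\asymp\tau(z)$ for some radial positive function $\tau(z)$ that decreases to $0$ as $|z|\to1^-$ and satisfies $\lim_{r\to1^-}\tau'(r)=0$; moreover, either there is a constant $C>0$ such that $\tau(r)(1-r)^{-C}$ increases for $r$ close to $1$, or $\lim_{r\to1^-}\tau'(r)\log\frac1{\tau(r)}=0$. The function $\tau$ is fixed with $\omega$. Since $\varphi$ is radial, $\varphi(z)=\varphi(|z|)$ and $\varphi'(z)$ denotes the derivative of $r\mapsto\varphi(r)$ at $r=|z|$. (The self-map $\phi$ and the weight function $\varphi$ are different objects.) Spaces: for $0<p<\infty$, $A^p_\omega$ is the set of $f\in H(\mathbb{D})$ with $\|f\|_{A^p_\omega}^p=\int_{\mathbb{D}}|f(z)|^p\omega(z)^{p/2}\,dA(z)<\infty$. Operators: for $f\in H(\mathbb{D})$, $z\in\mathbb{D}$, $GI_{(\phi,g)}f(z)=\int_0^z f'(\phi(\xi))\,g(\xi)\,d\xi$ and $GV_{(\phi,g)}f(z)=\int_0^z f(\phi(\xi))\,g(\xi)\,d\xi$. *)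

theory Defs
  imports "HOL-Complex_Analysis.Complex_Analysis"
begin

abbreviation unit_disk :: "complex set" where
  "unit_disk \<equiv> ball 0 1"

definition area :: "complex measure" where
  "area = scale_measure (ennreal (1 / pi)) (restrict_space lborel unit_disk)"

definition dx :: "(complex \<Rightarrow> real) \<Rightarrow> complex \<Rightarrow> real" where
  "dx u z = deriv (\<lambda>t::real. u (z + of_real t)) 0"

definition dy :: "(complex \<Rightarrow> real) \<Rightarrow> complex \<Rightarrow> real" where
  "dy u z = deriv (\<lambda>t::real. u (z + \<i> * of_real t)) 0"

definition C1_on :: "complex set \<Rightarrow> (complex \<Rightarrow> real) \<Rightarrow> bool" where
  "C1_on S u \<longleftrightarrow>
     (\<forall>z\<in>S. (\<lambda>t::real. u (z + of_real t)) differentiable (at 0) \<and>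
            (\<lambda>t::real. u (z + \<i> * of_real t)) differentiable (at 0)) \<and>
     continuous_on S (dx u) \<and> continuous_on S (dy u)"

definition C2_on :: "complex set \<Rightarrow> (complex \<Rightarrow> real) \<Rightarrow> bool" where
  "C2_on S u \<longleftrightarrow> C1_on S u \<and> C1_on S (dx u) \<and> C1_on S (dy u)"

definition laplacian :: "(complex \<Rightarrow> real) \<Rightarrow> complex \<Rightarrow> real" where
  "laplacian u z = dx (dx u) z + dy (dy u) z"

definition radial :: "(complex \<Rightarrow> real) \<Rightarrow> bool" where
  "radial u \<longleftrightarrow> (\<forall>z\<in>unit_disk. u z = u (of_real (norm z)))"

text \<open>The derivative of \<open>r \<mapsto> u r\<close> at \<open>r = \<bar>z\<bar>\<close>. For radial \<open>u\<close> of class \<open>C\<^sup>2\<close> it is \<open>0\<close> at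
  the origin, where the profile extends evenly to negative \<open>r\<close>.\<close>

definition radial_deriv :: "(complex \<Rightarrow> real) \<Rightarrow> complex \<Rightarrow> real" where
  "radial_deriv u z = deriv (\<lambda>r::real. u (of_real r)) (norm z)"

text \<open>\<open>class_W \<omega> \<phi> \<tau>\<close>: the weight \<open>\<omega> = exp (- 2 \<phi>)\<close> belongs to \<open>\<W>\<close>, with associated function \<open>\<tau>\<close>.
  Only values on the disk matter; monotonicity is understood in the non-strict sense, and
  the profile of \<open>\<tau>\<close> is taken to be differentiable on \<open>(0, 1)\<close>.\<close>

definition class_W ::
    "(complex \<Rightarrow> real) \<Rightarrow> (complex \<Rightarrow> real) \<Rightarrow> (complex \<Rightarrow> real) \<Rightarrow> bool" where
  "class_W \<omega> \<phi> \<tau> \<longleftrightarrow>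
     (\<forall>z\<in>unit_disk. \<omega> z = exp (- 2 * \<phi> z)) \<and>
     radial \<omega> \<and> antimono_on {0..<1} (\<lambda>r::real. \<omega> (of_real r)) \<and>
     radial \<phi> \<and> C2_on unit_disk \<phi> \<and>
     (\<forall>z\<in>unit_disk. laplacian \<phi> z > 0) \<and>
     (\<exists>c>0. \<exists>C>0. \<forall>z\<in>unit_disk.
        c * \<tau> z \<le> laplacian \<phi> z powr (- 1 / 2) \<and>
        laplacian \<phi> z powr (- 1 / 2) \<le> C * \<tau> z) \<and>
     radial \<tau> \<and> (\<forall>z\<in>unit_disk. \<tau> z > 0) \<and>
     antimono_on {0..<1} (\<lambda>r::real. \<tau> (of_real r)) \<and>
     ((\<lambda>r::real. \<tau> (of_real r)) \<longlongrightarrow> 0) (at_left 1) \<and>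
     (\<forall>r\<in>{0<..<1}. (\<lambda>r::real. \<tau> (of_real r)) differentiable (at r)) \<and>
     ((\<lambda>r. deriv (\<lambda>r::real. \<tau> (of_real r)) r) \<longlongrightarrow> 0) (at_left 1) \<and>
     ((\<exists>C>0. \<exists>r0\<in>{0<..<1}.
         mono_on {r0..<1} (\<lambda>r::real. \<tau> (of_real r) * (1 - r) powr (- C))) \<or>
      ((\<lambda>r. deriv (\<lambda>r::real. \<tau> (of_real r)) r * ln (1 / \<tau> (of_real r))) \<longlongrightarrow> 0) (at_left 1))"

text \<open>Elements of \<open>A\<^sup>p\<^sub>\<omega>\<close> are total functions of which only the values on the disk matter.\<close>

definition bergman :: "real \<Rightarrow> (complex \<Rightarrow> real) \<Rightarrow> (complex \<Rightarrow> complex) set" where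
  "bergman p \<omega> = {f. f holomorphic_on unit_disk \<and>
     integrable area (\<lambda>z. norm (f z) powr p * \<omega> z powr (p / 2))}"

definition bergman_norm :: "real \<Rightarrow> (complex \<Rightarrow> real) \<Rightarrow> (complex \<Rightarrow> complex) \<Rightarrow> real" where
  "bergman_norm p \<omega> f =
     (integral\<^sup>L area (\<lambda>z. norm (f z) powr p * \<omega> z powr (p / 2))) powr (1 / p)"

definition bounded_op ::
    "real \<Rightarrow> real \<Rightarrow> (complex \<Rightarrow> real) \<Rightarrow> ((complex \<Rightarrow> complex) \<Rightarrow> complex \<Rightarrow> complex) \<Rightarrow> bool" where
  "bounded_op p q \<omega> T \<longleftrightarrow>
     (\<forall>f\<in>bergman p \<omega>. T f \<in> bergman q \<omega>) \<and>
     (\<exists>C. \<forall>f\<in>bergman p \<omega>. bergman_norm q \<omega> (T f) \<le> C * bergman_norm p \<omega> f)"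

text \<open>For exponents below \<open>1\<close> the functional \<open>bergman_norm\<close> is only a quasi-norm, but it still induces
  a metrizable topology, so compactness may be stated with sequences.\<close>

definition compact_op ::
    "real \<Rightarrow> real \<Rightarrow> (complex \<Rightarrow> real) \<Rightarrow> ((complex \<Rightarrow> complex) \<Rightarrow> complex \<Rightarrow> complex) \<Rightarrow> bool" where
  "compact_op p q \<omega> T \<longleftrightarrow>
     (\<forall>f\<in>bergman p \<omega>. T f \<in> bergman q \<omega>) \<and>
     (\<forall>F::nat \<Rightarrow> complex \<Rightarrow> complex.
        (\<forall>n. F n \<in> bergman p \<omega>) \<and> (\<exists>M. \<forall>n. bergman_norm p \<omega> (F n) \<le> M) \<longrightarrow>
        (\<exists>h\<in>bergman q \<omega>. \<exists>s::nat \<Rightarrow> nat. strict_mono s \<and>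
           (\<lambda>n. bergman_norm q \<omega> (\<lambda>z. T (F (s n)) z - h z)) \<longlonglongrightarrow> 0))"

definition GI :: "(complex \<Rightarrow> complex) \<Rightarrow> (complex \<Rightarrow> complex) \<Rightarrow> (complex \<Rightarrow> complex) \<Rightarrow> complex \<Rightarrow> complex" where
  "GI \<psi> g f z = contour_integral (linepath 0 z) (\<lambda>\<xi>. deriv f (\<psi> \<xi>) * g \<xi>)"

definition GV :: "(complex \<Rightarrow> complex) \<Rightarrow> (complex \<Rightarrow> complex) \<Rightarrow> (complex \<Rightarrow> complex) \<Rightarrow> complex \<Rightarrow> complex" where
  "GV \<psi> g f z = contour_integral (linepath 0 z) (\<lambda>\<xi>. f (\<psi> \<xi>) * g \<xi>)"

definition L_infinity :: "'a measure \<Rightarrow> ('a \<Rightarrow> real) set" where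
  "L_infinity M = {F \<in> borel_measurable M. \<exists>C. AE z in M. \<bar>F z\<bar> \<le> C}"

text \<open>The filter on the disk describing \<open>\<bar>u z\<bar> \<rightarrow> 1\<^sup>-\<close>; it is \<open>bot\<close> if \<open>\<bar>u\<bar>\<close> stays away from \<open>1\<close>.\<close>

definition to_boundary :: "(complex \<Rightarrow> complex) \<Rightarrow> complex filter" where
  "to_boundary u = inf (principal unit_disk) (filtercomap (\<lambda>z. norm (u z)) (at_left 1))"

end

theory Submission
  imports Defs
begin

text \<open>
  Differentiation removes the integral from the operators \<open>S\<close> in question: \<open>(GI f)' = f' \<circ> \<psi> \<cdot> g\<close> and
  \<open>(GV f)' = f \<circ> \<psi> \<cdot> g\<close>. Hence the theorem follows from an upper bound for derivatives in the
  target space and from functions in the source space for which the relevant value is large.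

  \<^bold>\<open>Upper bound.\<close> On the disk \<open>B\<close> of radius \<open>\<delta> \<tau>(z)\<close> around \<open>z\<close> the weight \<open>\<phi>\<close> lies below the real
  part of a holomorphic \<open>H\<close>, up to a constant, with equality at \<open>z\<close> and \<open>\<bar>H'(z)\<bar> \<le> \<phi>'(z)\<close>: for radial
  \<open>\<phi>\<close> the tangent in the variable \<open>log \<bar>\<zeta>\<bar>\<close> does this (\<open>local_holomorphic_majorant\<close>).
  The unweighted function \<open>u = h exp (- H)\<close> and its derivative at \<open>z\<close> are bounded by the integral of
  \<open>\<bar>u\<bar>^q\<close> over \<open>B\<close>, for every \<open>q > 0\<close> (\<open>large_on_ball_of_maximal_point\<close>). As
  \<open>1 / \<tau> \<le> C (1 + \<phi>')\<close> (\<open>inverse_tau_le_deriv\<close>), this gives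
  \<open>\<bar>h'(z)\<bar> \<omega>(z)^(1/2) \<tau>(z)^(2/q) / (1 + \<phi>'(z)) \<le> C (\<integral>\<^sub>B \<bar>h\<bar>^q \<omega>^(q/2) dA)^(1/q)\<close>
  (\<open>derivative_bounded_by_local_norm\<close>). The right side is at most \<open>C \<parallel>h\<parallel>\<close>, and for fixed \<open>h\<close> it
  tends to \<open>0\<close> at the boundary, because \<open>B\<close> moves out to the boundary.

  \<^bold>\<open>Test functions.\<close> For \<open>\<bar>a\<bar> \<ge> 1/2\<close> let \<open>f(z) = (z/a)^N ((1/m) \<Sum>\<^sub>j\<^sub><\<^sub>m (z/a)^j)^k\<close> with \<open>N\<close> about
  \<open>\<bar>a\<bar> \<phi>'(a)\<close>, \<open>m\<close> about \<open>1/\<tau>(a)\<close> and \<open>k \<ge> 4/p\<close>. The monomial, multiplied by \<open>exp (- \<phi>)\<close>, peaks on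
  the circle through \<open>a\<close>; the average cuts out an arc of length \<open>\<tau>(a)\<close>. Convexity of \<open>\<phi>\<close> in
  \<open>log \<bar>z\<bar>\<close>, which outside the circle is as strong as \<open>1/\<tau>(a)^2\<close>, absorbs the growth of the average, so
  \<open>\<bar>f\<bar> exp (\<phi>(a) - \<phi>) \<le> K (\<tau>(a) / (\<tau>(a) + \<bar>z - a\<bar>))^k\<close> (\<open>weighted_peak_bound\<close>). The \<open>p\<close>-th power
  has integral at most \<open>C \<tau>(a)^2\<close>, while \<open>f(a) = 1\<close> and \<open>\<bar>f'(a)\<bar> \<ge> N / \<bar>a\<bar> \<ge> 1 + \<phi>'(a)\<close>
  (\<open>peak_in_bergman\<close>). Near the origin \<open>1\<close> and \<open>z\<close> serve.

  \<^bold>\<open>Conclusion.\<close> Boundedness is obtained by applying the upper bound to \<open>S f\<close> with \<open>f\<close> the normalized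
  test function at \<open>a = \<psi>(z)\<close> (\<open>symbol_bounded\<close>). If \<open>S\<close> is compact and \<open>\<bar>z\<^sub>n\<bar> \<rightarrow> 1\<close>, a subsequence of
  the images \<open>S f\<^sub>n\<close> converges in norm to some \<open>h\<close>; the upper bound for \<open>S f\<^sub>n - h\<close> tends to \<open>0\<close> with
  the norm, and the quantity for \<open>h\<close> itself tends to \<open>0\<close> at \<open>z\<^sub>n\<close> (\<open>symbol_vanishes\<close>).
  Finally \<open>\<bar>\<psi>(z)\<bar> \<rightarrow> 1\<close> forces \<open>\<bar>z\<bar> \<rightarrow> 1\<close>, as \<open>\<bar>\<psi>\<bar>\<close> has a maximum below \<open>1\<close> on each smaller closed disk.
\<close>

section \<open>The normalized area measure of the disk\<close>

lemma space_area [simp]: "space area = unit_disk"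
  by (simp add: area_def space_scale_measure space_restrict_space)

lemma sets_area: "sets area = sets (restrict_space borel unit_disk)"
  unfolding area_def sets_scale_measure by (simp cong: sets_restrict_space_cong)

lemma borel_measurable_area_iff:
  "f \<in> borel_measurable area \<longleftrightarrow> f \<in> borel_measurable (restrict_space borel unit_disk)"
  by (simp add: sets_area cong: measurable_cong_sets)

lemma borel_measurable_area_continuous:
  fixes f :: "complex \<Rightarrow> 'b::topological_space"
  assumes "continuous_on unit_disk f"
  shows "f \<in> borel_measurable area"
  by (simp add: borel_measurable_area_iff assms borel_measurable_continuous_on_restrict)

lemma sets_area_ball: "ball c r \<subseteq> unit_disk \<Longrightarrow> ball c r \<in> sets area"
  by (auto simp: sets_area sets_restrict_space intro!: image_eqI[of _ _ "ball c r"])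

lemma emeasure_area_ball:
  assumes "ball c r \<subseteq> unit_disk" "0 \<le> r"
  shows "emeasure area (ball c r) = ennreal (r\<^sup>2)"
proof -
  have "emeasure area (ball c r) = ennreal (1/pi) * emeasure lborel (ball c r)"
    using assms by (simp add: area_def emeasure_restrict_space)
  also have "\<dots> = ennreal (1/pi) * ennreal (pi * r\<^sup>2)"
    using assms by (simp add: emeasure_ball unit_ball_vol_2)
  also have "\<dots> = ennreal (r\<^sup>2)"
    by (subst ennreal_mult[symmetric]) auto
  finally show ?thesis .
qed

lemma finite_measure_area: "finite_measure area"
  by standard (use emeasure_area_ball[of 0 1] in simp)

lemma nn_integral_area_le:
  assumes "f \<in> borel_measurable borel"
  shows "(\<integral>\<^sup>+z. f z \<partial>area) \<le> (\<integral>\<^sup>+z. f z \<partial>lborel)"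
proof -
  have "(\<integral>\<^sup>+z. f z \<partial>area) = ennreal (1/pi) * (\<integral>\<^sup>+z. f z * indicator unit_disk z \<partial>lborel)"
    unfolding area_def using assms
    by (subst nn_integral_scale_measure)
       (auto simp: nn_integral_restrict_space intro!: measurable_restrict_space1)
  also have "\<dots> \<le> 1 * (\<integral>\<^sup>+z. f z \<partial>lborel)"
    using pi_gt3 by (intro mult_mono nn_integral_mono) (auto simp: indicator_def ennreal_le_1)
  finally show ?thesis by simp
qed

text \<open>The kernel is of size \<open>16^(- n)\<close> on the dyadic shell \<open>2^(n - 1) R \<le> x < 2^n R\<close>, so it is dominated
  by a sum of indicators of balls, whose area is known exactly.\<close>
lemma quartic_kernel_le_dyadic_sum:
  fixes x R :: real
  assumes "R > 0" "x \<ge> 0"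
  shows "ennreal ((R / (R + x)) ^ 4)
           \<le> (\<Sum>n. ennreal (16 * (1/16) ^ n) * indicator {y. y < 2 ^ n * R} x)"
proof -
  have "\<exists>n. x < 2 ^ n * R"
    using real_arch_pow[of 2 "x / R"] assms by (auto simp: field_simps)
  then obtain n where n: "x < 2 ^ n * R" and least: "\<And>k. k < n \<Longrightarrow> \<not> x < 2 ^ k * R"
    using exists_least_iff[of "\<lambda>n. x < 2 ^ n * R"] by blast
  have "(R / (R + x)) ^ 4 \<le> 16 * (1/16) ^ n"
  proof (cases n)
    case 0
    have "(R / (R + x)) ^ 4 \<le> 1"
      using assms by (intro power_le_one) auto
    then show ?thesis using 0 by simp
  next
    case (Suc k)
    have "2 ^ k * R \<le> x" using least[of k] Suc by auto
    then have "R / (R + x) \<le> 1 / 2 ^ k"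
      using assms by (simp add: field_simps)
    then have "(R / (R + x)) ^ 4 \<le> (1 / 2 ^ k) ^ 4"
      using assms by (intro power_mono) auto
    also have "\<dots> = ((1/2) ^ 4) ^ k"
      by (metis power_mult mult.commute power_one_over)
    also have "\<dots> = 16 * (1/16) ^ n"
      using Suc by (simp add: power_one_over)
    finally show ?thesis .
  qed
  then have "ennreal ((R / (R + x)) ^ 4)
      \<le> ennreal (16 * (1/16) ^ n) * indicator {y. y < 2 ^ n * R} x"
    using n by (simp add: ennreal_leI)
  also have "\<dots> = (\<Sum>n\<in>{n}. ennreal (16 * (1/16) ^ n) * indicator {y. y < 2 ^ n * R} x)"
    by (subst sum.insert) auto
  also have "\<dots> \<le> (\<Sum>n. ennreal (16 * (1/16) ^ n) * indicator {y. y < 2 ^ n * R} x)"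
    by (rule sum_le_suminf) auto
  finally show ?thesis .
qed

lemma nn_integral_quartic_kernel:
  fixes a :: complex
  assumes "R > 0"
  shows "(\<integral>\<^sup>+z. ennreal ((R / (R + norm (z - a))) ^ 4) \<partial>area) \<le> ennreal (64 / 3 * pi * R\<^sup>2)"
proof -
  have "(\<integral>\<^sup>+z. ennreal ((R / (R + norm (z - a))) ^ 4) \<partial>area)
      \<le> (\<integral>\<^sup>+z. ennreal ((R / (R + norm (z - a))) ^ 4) \<partial>lborel)"
    by (rule nn_integral_area_le) measurable
  also have "\<dots> \<le> (\<integral>\<^sup>+z. (\<Sum>n. ennreal (16 * (1/16) ^ n) * indicator (ball a (2 ^ n * R)) z) \<partial>lborel)"
  proof (rule nn_integral_mono)
    fix z
    have "indicator {y. y < 2 ^ n * R} (norm (z - a)) = (indicator (ball a (2 ^ n * R)) z :: ennreal)" for n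
      by (auto simp: indicator_def dist_norm norm_minus_commute)
    then show "ennreal ((R / (R + norm (z - a))) ^ 4)
        \<le> (\<Sum>n. ennreal (16 * (1/16) ^ n) * indicator (ball a (2 ^ n * R)) z)"
      using quartic_kernel_le_dyadic_sum[OF assms, of "norm (z - a)"] by simp
  qed
  also have "\<dots> = (\<Sum>n. ennreal (16 * (1/16) ^ n) * emeasure lborel (ball a (2 ^ n * R)))"
    by (subst nn_integral_suminf)
       (auto simp: nn_integral_cmult_indicator intro!: borel_measurable_times_ennreal borel_measurable_indicator)
  also have "\<dots> = (\<Sum>n. ennreal (16 * pi * R\<^sup>2 * (1/4) ^ n))"
  proof (rule suminf_cong)
    fix n
    have "ennreal (16 * (1/16) ^ n) * emeasure lborel (ball a (2 ^ n * R))
        = ennreal (16 * (1/16) ^ n * (pi * (2 ^ n * R)\<^sup>2))"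
      using assms by (simp add: emeasure_ball unit_ball_vol_2 ennreal_mult)
    also have "16 * (1/16) ^ n * (pi * (2 ^ n * R)\<^sup>2) = 16 * pi * R\<^sup>2 * ((1/16) ^ n * (2 ^ n)\<^sup>2)"
      by (simp add: power_mult_distrib)
    also have "(1/16) ^ n * (2 ^ n)\<^sup>2 = ((1/4) ^ n :: real)"
      by (simp add: power_mult[symmetric] power_mult_distrib[symmetric] mult.commute[of n]
               flip: power_mult) (simp add: power_mult power_mult_distrib[symmetric])
    finally show "ennreal (16 * (1/16) ^ n) * emeasure lborel (ball a (2 ^ n * R))
      = ennreal (16 * pi * R\<^sup>2 * (1/4) ^ n)" .
  qed
  also have "\<dots> = ennreal (64 / 3 * pi * R\<^sup>2)"
  proof (rule suminf_ennreal_eq)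
    have "(\<lambda>n. 16 * pi * R\<^sup>2 * (1/4) ^ n) sums (16 * pi * R\<^sup>2 * (1 / (1 - 1/4)))"
      by (intro sums_mult geometric_sums) auto
    then show "(\<lambda>n. 16 * pi * R\<^sup>2 * (1/4) ^ n) sums (64 / 3 * pi * R\<^sup>2)"
      by (simp add: mult_ac)
  qed auto
  finally show ?thesis .
qed

section \<open>Integral control of point values of a holomorphic function\<close>

text \<open>A substitute for subharmonicity of \<open>\<bar>u\<bar>^q\<close> that treats all exponents \<open>q > 0\<close> alike. Choose \<open>z0\<close>
  maximizing \<open>\<bar>u\<bar>\<close> times the power \<open>\<beta>\<close> (later \<open>2/q\<close>) of the distance to the circle, and let \<open>d\<close> be that
  distance at \<open>z0\<close>. Maximality bounds \<open>\<bar>u\<bar>\<close> by \<open>2^\<beta> \<bar>u(z0)\<bar>\<close> on the disk of radius \<open>d/2\<close>; by Cauchy's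
  inequality \<open>u\<close> then varies slowly, and stays above \<open>\<bar>u(z0)\<bar>/2\<close> on a disk of radius proportional to
  \<open>d\<close>. The integral of \<open>\<bar>u\<bar>^q\<close> over that small disk controls \<open>\<bar>u(z0)\<bar>^q d^2\<close>, hence every value of \<open>u\<close>.\<close>
lemma large_on_ball_of_maximal_point:
  fixes u :: "complex \<Rightarrow> complex" and c :: complex and \<beta> R :: real
  assumes holo: "u holomorphic_on S" and S: "open S" "cball c R \<subseteq> S" and R: "R > 0" and \<beta>: "\<beta> > 0"
  shows "\<exists>z0 d. d > 0 \<and> ball z0 (d / (8 * 2 powr \<beta>)) \<subseteq> ball c R \<and>
           (\<forall>z\<in>ball z0 (d / (8 * 2 powr \<beta>)). norm (u z0) / 2 \<le> norm (u z)) \<and>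
           (\<forall>z\<in>cball c R. norm (u z) * (R - norm (z - c)) powr \<beta> \<le> norm (u z0) * d powr \<beta>)"
proof -
  let ?v = "\<lambda>z. norm (u z) * (R - norm (z - c)) powr \<beta>"
  have "continuous_on (cball c R) u"
    using holo S holomorphic_on_imp_continuous_on holomorphic_on_subset by blast
  then have "continuous_on (cball c R) ?v"
    using \<beta> by (intro continuous_intros continuous_on_powr') (auto simp: dist_norm norm_minus_commute)
  then obtain z0 where z0: "z0 \<in> cball c R" and max: "\<And>z. z \<in> cball c R \<Longrightarrow> ?v z \<le> ?v z0"
    using continuous_attains_sup[of "cball c R" ?v] R by force
  show ?thesis
  proof (cases "?v z0 = 0")
    case True
    have ge1: "1 \<le> 8 * 2 powr \<beta>" using \<beta> ge_one_powr_ge_zero[of 2 \<beta>] by simp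
    have zero: "u z = 0" if "z \<in> ball c R" for z
    proof -
      have "?v z \<le> 0" using max[of z] that True by auto
      moreover have "(R - norm (z - c)) powr \<beta> > 0"
        using that by (auto simp: dist_norm norm_minus_commute)
      ultimately show ?thesis by (simp add: mult_le_0_iff)
    qed
    have sub: "ball c (R / (8 * 2 powr \<beta>)) \<subseteq> ball c R"
    proof (rule subset_ball)
      show "R / (8 * 2 powr \<beta>) \<le> R" using ge1 R by (simp add: divide_le_eq)
    qed
    show ?thesis
      using R max sub zero True
      by (intro exI[of _ c] exI[of _ R]) auto
  next
    case False
    \<comment> \<open>\<open>d > 0\<close> is the distance from \<open>z0\<close> to the circle; it is at least \<open>d/2\<close> on the disk of radius \<open>d/2\<close>.\<close>
    define d where "d = R - norm (z0 - c)"
    define r where "r = d / (8 * 2 powr \<beta>)"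
    have nz: "norm (u z0) > 0" using False by auto
    have "d \<noteq> 0" using False by (auto simp: d_def)
    moreover have "d \<ge> 0" using z0 by (auto simp: d_def dist_norm norm_minus_commute)
    ultimately have d: "d > 0" by simp
    have ge1: "1 \<le> 2 powr \<beta>" using \<beta> ge_one_powr_ge_zero[of 2 \<beta>] by simp
    have r: "0 < r" "r \<le> d / 8" using d ge1 by (auto simp: r_def field_simps)
    have far: "d / 2 \<le> R - norm (z - c)" if "norm (z - z0) \<le> d / 2" for z
      using norm_triangle_ineq[of "z - z0" "z0 - c"] that by (simp add: d_def)
    have inS: "cball z0 (d/2) \<subseteq> cball c R"
    proof
      fix z assume "z \<in> cball z0 (d/2)"
      then show "z \<in> cball c R"
        using far[of z] d by (auto simp: dist_norm norm_minus_commute)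
    qed
    have ub: "norm (u z) \<le> 2 powr \<beta> * norm (u z0)" if z: "norm (z - z0) \<le> d / 2" for z
    proof -
      have "norm (u z) * (d / 2) powr \<beta> \<le> ?v z"
        using far[OF z] d \<beta> by (intro mult_left_mono powr_mono2) auto
      also have "\<dots> \<le> norm (u z0) * d powr \<beta>"
        using max[of z] inS z by (auto simp: d_def dist_norm norm_minus_commute)
      also have "d powr \<beta> = (d / 2) powr \<beta> * 2 powr \<beta>"
        using d by (simp add: powr_divide)
      finally have "norm (u z) * (d / 2) powr \<beta> \<le> (2 powr \<beta> * norm (u z0)) * (d / 2) powr \<beta>"
        by (simp add: mult_ac)
      then show ?thesis using d by (simp add: mult_le_cancel_right)
    qed
    have deriv_bound: "norm (deriv u z) \<le> 2 powr \<beta> * norm (u z0) / (d / 4)" if z: "z \<in> cball z0 (d/4)" for z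
    proof -
      have sub: "cball z (d/4) \<subseteq> cball z0 (d/2)"
        using z by (simp add: cball_subset_cball_iff dist_norm norm_minus_commute)
      then have sub': "cball z (d/4) \<subseteq> S" using inS S by blast
      have "norm ((deriv ^^ 1) u z) \<le> fact 1 * (2 powr \<beta> * norm (u z0)) / (d/4) ^ 1"
      proof (rule Cauchy_inequality)
        show "u holomorphic_on ball z (d/4)"
          using holo sub' holomorphic_on_subset ball_subset_cball by blast
        show "continuous_on (cball z (d/4)) u"
          using holo sub' holomorphic_on_imp_continuous_on holomorphic_on_subset by blast
        fix x assume "norm (z - x) = d/4"
        then have "x \<in> cball z (d/4)" by (simp add: dist_norm)
        then have "x \<in> cball z0 (d/2)" using sub by blast
        then show "norm (u x) \<le> 2 powr \<beta> * norm (u z0)"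
          using ub[of x] by (simp add: dist_norm norm_minus_commute)
      qed (use d in auto)
      then show ?thesis by simp
    qed
    have low: "norm (u z0) / 2 \<le> norm (u z)" if z: "z \<in> ball z0 r" for z
    proof -
      have z4: "z \<in> cball z0 (d/4)" using z r d by (auto simp: dist_norm)
      have "norm (u z - u z0) \<le> 2 powr \<beta> * norm (u z0) / (d / 4) * norm (z - z0)"
      proof (rule field_differentiable_bound[of "cball z0 (d/4)" u "deriv u"])
        fix w assume w: "w \<in> cball z0 (d/4)"
        moreover have "cball z0 (d/4) \<subseteq> cball z0 (d/2)" using d by (intro subset_cball) auto
        ultimately have "w \<in> S" using inS S by blast
        then show "(u has_field_derivative deriv u w) (at w within cball z0 (d/4))"
          using holo S(1) holomorphic_derivI by blast
      qed (use z4 d deriv_bound in auto)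
      also have "\<dots> \<le> 2 powr \<beta> * norm (u z0) / (d / 4) * r"
        using z d by (intro mult_left_mono) (auto simp: dist_norm norm_minus_commute)
      also have "\<dots> = norm (u z0) / 2"
        using d by (simp add: r_def field_simps)
      finally show ?thesis
        using norm_triangle_ineq2[of "u z0" "u z"] by (simp add: norm_minus_commute)
    qed
    have "ball z0 r \<subseteq> cball z0 (d/2)" using r d by auto
    then have "ball z0 r \<subseteq> interior (cball c R)"
      using inS by (intro interior_maximal) auto
    then have "ball z0 r \<subseteq> ball c R" by simp
    with low max d show ?thesis
      unfolding r_def d_def by blast
  qed
qed

section \<open>Powers of geometric averages\<close>

text \<open>Both the trivial bound and the one from \<open>(w - 1) \<Sum>\<^sub>j\<^sub><\<^sub>m w^j = w^m - 1\<close> carry the growth factor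
  \<open>max 1 \<bar>w\<bar>^m\<close>; adding them gives decay away from \<open>1\<close> at scale \<open>1/m\<close>.\<close>
lemma norm_geometric_average_le:
  fixes w :: complex
  assumes "m > 0"
  shows "norm ((\<Sum>j<m. w ^ j) / of_nat m) \<le> 3 * (max 1 (norm w)) ^ m / (1 + m * norm (w - 1))"
proof -
  define M where "M = (max 1 (norm w)) ^ m"
  let ?D = "norm ((\<Sum>j<m. w ^ j) / of_nat m)"
  have "norm (\<Sum>j<m. w ^ j) \<le> (\<Sum>j<m. M)"
  proof (rule sum_norm_le)
    fix j assume j: "j \<in> {..<m}"
    have "norm (w ^ j) \<le> max 1 (norm w) ^ j"
      unfolding norm_power by (intro power_mono) auto
    also have "\<dots> \<le> M" unfolding M_def using j by (intro power_increasing) auto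
    finally show "norm (w ^ j) \<le> M" .
  qed
  then have 1: "?D \<le> M" using assms by (simp add: norm_divide field_simps)
  have M: "1 \<le> M" "norm w ^ m \<le> M" unfolding M_def by (auto intro: one_le_power power_mono)
  have "?D * (m * norm (w - 1)) = norm (w ^ m - 1)"
    using assms by (simp add: power_diff_1_eq norm_mult norm_divide)
  also have "\<dots> \<le> norm (w ^ m) + norm (1::complex)" by (rule norm_triangle_ineq4)
  also have "\<dots> \<le> 2 * M" using M by (simp add: norm_power)
  finally have "?D * (1 + m * norm (w - 1)) \<le> 3 * M"
    using 1 by (simp add: algebra_simps)
  moreover have "0 < 1 + m * norm (w - 1)" by (simp add: add_pos_nonneg)
  ultimately show ?thesis unfolding M_def by (simp add: pos_le_divide_eq)
qed

text \<open>With argument \<open>z/a\<close> this is the test function concentrated at \<open>a\<close>: the power fixes the radius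
  where it is largest against the weight, the averages localize the argument.\<close>
definition peak :: "nat \<Rightarrow> nat \<Rightarrow> nat \<Rightarrow> complex \<Rightarrow> complex" where
  "peak N m k w = w ^ N * ((\<Sum>j<m. w ^ j) / of_nat m) ^ k"

lemma peak_at_1: "m > 0 \<Longrightarrow> peak N m k 1 = 1"
  by (simp add: peak_def)

lemma peak_holomorphic: "f holomorphic_on S \<Longrightarrow> (\<lambda>z. peak N m k (f z)) holomorphic_on S"
  unfolding peak_def by (cases "m = 0") (auto intro!: holomorphic_intros)

lemma DERIV_peak_at_1:
  assumes "m > 0"
  shows "(peak N m k has_field_derivative of_real (N + k * ((\<Sum>j<m. real j) / m))) (at 1)"
proof -
  have "((\<lambda>w::complex. (\<Sum>j<m. w ^ j) / of_nat m) has_field_derivative (\<Sum>j<m. of_nat j) / of_nat m) (at 1)"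
    using assms by (auto intro!: derivative_eq_intros)
  from DERIV_mult[OF DERIV_power[OF DERIV_ident, where n = N] DERIV_power[OF this, where n = k]] assms
  show ?thesis
    unfolding peak_def by (simp add: mult_ac)
qed

section \<open>Integration operators and the boundary filter\<close>

lemma DERIV_contour_integral_linepath:
  assumes F: "F holomorphic_on unit_disk" and z: "z \<in> unit_disk"
  shows "((\<lambda>z. contour_integral (linepath 0 z) F) has_field_derivative F z) (at z)"
proof -
  obtain P where P: "\<And>x. x \<in> unit_disk \<Longrightarrow> (P has_field_derivative F x) (at x within unit_disk)"
    using holomorphic_convex_primitive'[OF convex_ball open_ball F] by blast
  have eq: "P w - P 0 = contour_integral (linepath 0 w) F" if "w \<in> unit_disk" for w
  proof -
    have "closed_segment 0 w \<subseteq> unit_disk"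
      by (rule closed_segment_subset) (use that in auto)
    then have "(F has_contour_integral P (pathfinish (linepath 0 w)) - P (pathstart (linepath 0 w))) (linepath 0 w)"
      using P by (intro contour_integral_primitive[of unit_disk P F]) auto
    then show ?thesis by (simp add: contour_integral_unique)
  qed
  have "((\<lambda>w. P w - P 0) has_field_derivative F z - 0) (at z)"
    using P[OF z] z by (intro DERIV_diff DERIV_const) (simp add: at_within_open[OF z open_ball])
  then have "((\<lambda>w. P w - P 0) has_field_derivative F z) (at z)" by simp
  then show ?thesis
    by (rule has_field_derivative_transform_within_open[OF _ open_ball z]) (use eq in auto)
qed

lemma deriv_GI:
  assumes "f holomorphic_on unit_disk" "\<psi> holomorphic_on unit_disk" "\<psi> ` unit_disk \<subseteq> unit_disk"
    "g holomorphic_on unit_disk" "z \<in> unit_disk"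
  shows "deriv (GI \<psi> g f) z = deriv f (\<psi> z) * g z"
proof -
  have "(deriv f \<circ> \<psi>) holomorphic_on unit_disk"
    using assms by (intro holomorphic_on_compose_gen[where t = unit_disk] holomorphic_deriv) auto
  then have "(\<lambda>\<xi>. deriv f (\<psi> \<xi>) * g \<xi>) holomorphic_on unit_disk"
    using assms by (auto intro!: holomorphic_intros simp: o_def)
  from DERIV_contour_integral_linepath[OF this assms(5)] show ?thesis
    unfolding GI_def[abs_def] by (rule DERIV_imp_deriv)
qed

lemma deriv_GV:
  assumes "f holomorphic_on unit_disk" "\<psi> holomorphic_on unit_disk" "\<psi> ` unit_disk \<subseteq> unit_disk"
    "g holomorphic_on unit_disk" "z \<in> unit_disk"
  shows "deriv (GV \<psi> g f) z = f (\<psi> z) * g z"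
proof -
  have "(f \<circ> \<psi>) holomorphic_on unit_disk"
    using assms by (intro holomorphic_on_compose_gen[where t = unit_disk]) auto
  then have "(\<lambda>\<xi>. f (\<psi> \<xi>) * g \<xi>) holomorphic_on unit_disk"
    using assms by (auto intro!: holomorphic_intros simp: o_def)
  from DERIV_contour_integral_linepath[OF this assms(5)] show ?thesis
    unfolding GV_def[abs_def] by (rule DERIV_imp_deriv)
qed

lemma eventually_to_boundaryI:
  assumes "s < 1" "\<And>z. z \<in> unit_disk \<Longrightarrow> s < norm (u z) \<Longrightarrow> P z"
  shows "eventually P (to_boundary u)"
proof -
  have "eventually (\<lambda>x::real. s < x) (at_left 1)"
    using assms(1) unfolding eventually_at_left_field by blast
  then have "eventually (\<lambda>z. s < norm (u z)) (filtercomap (\<lambda>z. norm (u z)) (at_left 1))"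
    by (rule eventually_filtercomapI)
  then have "eventually (\<lambda>z. z \<in> unit_disk \<longrightarrow> P z) (filtercomap (\<lambda>z. norm (u z)) (at_left 1))"
    by (rule eventually_mono) (use assms(2) in blast)
  then show ?thesis
    unfolding to_boundary_def by (subst inf.commute) (simp only: eventually_inf_principal)
qed

text \<open>On \<open>\<bar>z\<bar> \<le> r\<close> the continuous function \<open>\<bar>\<psi>\<bar>\<close> has a maximum \<open>s < 1\<close>, so \<open>\<bar>\<psi>(z)\<bar> > s\<close> implies
  \<open>\<bar>z\<bar> > r\<close>: a limit at the boundary is also a limit for \<open>\<bar>\<psi>(z)\<bar> \<rightarrow> 1\<close>.\<close>
lemma tendsto_to_boundary_self_map:
  fixes W :: "complex \<Rightarrow> real"
  assumes \<psi>: "\<psi> holomorphic_on unit_disk" "\<psi> ` unit_disk \<subseteq> unit_disk"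
    and W: "\<And>\<epsilon>. \<epsilon> > 0 \<Longrightarrow> \<exists>r<1. \<forall>z\<in>unit_disk. r < norm z \<longrightarrow> \<bar>W z\<bar> < \<epsilon>"
  shows "(W \<longlongrightarrow> 0) (to_boundary \<psi>)"
proof (rule tendstoI)
  fix \<epsilon> :: real assume "\<epsilon> > 0"
  then obtain r where r: "r < 1" "\<And>z. z \<in> unit_disk \<Longrightarrow> r < norm z \<Longrightarrow> \<bar>W z\<bar> < \<epsilon>"
    using W by blast
  define r' where "r' = max 0 r"
  have r': "0 \<le> r'" "r' < 1" "r \<le> r'" using r by (auto simp: r'_def)
  have sub: "cball 0 r' \<subseteq> unit_disk" using r' by auto
  have "continuous_on (cball 0 r') (\<lambda>z. norm (\<psi> z))"
    using holomorphic_on_imp_continuous_on[OF \<psi>(1)] sub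
    by (intro continuous_intros) (rule continuous_on_subset)
  then obtain x where x: "x \<in> cball 0 r'" and max: "\<And>z. z \<in> cball 0 r' \<Longrightarrow> norm (\<psi> z) \<le> norm (\<psi> x)"
    using continuous_attains_sup[of "cball 0 r'" "\<lambda>z. norm (\<psi> z)"] r' by auto
  have "norm (\<psi> x) < 1" using x sub \<psi>(2) by fastforce
  then show "\<forall>\<^sub>F z in to_boundary \<psi>. dist (W z) 0 < \<epsilon>"
  proof (rule eventually_to_boundaryI)
    fix z assume z: "z \<in> unit_disk" "norm (\<psi> x) < norm (\<psi> z)"
    then have "r < norm z" using max[of z] r' by (auto simp: not_le[symmetric])
    then show "dist (W z) 0 < \<epsilon>" using r(2) z by simp
  qed
qed

lemma self_map_measurable:
  assumes "\<psi> holomorphic_on unit_disk" "\<psi> ` unit_disk \<subseteq> unit_disk"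
  shows "\<psi> \<in> area \<rightarrow>\<^sub>M area"
proof -
  have "\<psi> \<in> borel_measurable area"
    by (intro borel_measurable_area_continuous holomorphic_on_imp_continuous_on assms)
  then have "\<psi> \<in> area \<rightarrow>\<^sub>M restrict_space borel unit_disk"
    using assms(2) by (intro measurable_restrict_space2) auto
  then show ?thesis by (simp add: sets_area cong: measurable_cong_sets)
qed

section \<open>Calculus of the radial weight\<close>

text \<open>The whole analysis takes place on the radius: \<open>\<Phi>\<close> and \<open>T\<close> are the profiles of \<open>\<phi>\<close> and \<open>\<tau>\<close>. The
  quantity \<open>flux r = r \<Phi>'(r)\<close> is the derivative of \<open>\<phi>\<close> with respect to \<open>log r\<close>, and \<open>2 \<pi>\<close> times it is the
  flux of the gradient of \<open>\<phi>\<close> through the circle of radius \<open>r\<close>.\<close>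
locale rapid_weight =
  fixes \<omega> \<phi> \<tau> :: "complex \<Rightarrow> real"
  assumes class_W: "class_W \<omega> \<phi> \<tau>"
begin

abbreviation \<Phi> :: "real \<Rightarrow> real" where "\<Phi> r \<equiv> \<phi> (of_real r)"
abbreviation \<Phi>' :: "real \<Rightarrow> real" where "\<Phi>' r \<equiv> dx \<phi> (of_real r)"
abbreviation T :: "real \<Rightarrow> real" where "T r \<equiv> \<tau> (of_real r)"
abbreviation flux :: "real \<Rightarrow> real" where "flux r \<equiv> r * \<Phi>' r"

lemma omega_eq: "z \<in> unit_disk \<Longrightarrow> \<omega> z = exp (- 2 * \<phi> z)"
  using class_W by (simp add: class_W_def)

lemma phi_radial: "z \<in> unit_disk \<Longrightarrow> \<phi> z = \<Phi> (norm z)"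
  and tau_radial: "z \<in> unit_disk \<Longrightarrow> \<tau> z = T (norm z)"
  and tau_pos: "z \<in> unit_disk \<Longrightarrow> \<tau> z > 0"
  and T_antimono_on: "antimono_on {0..<1} T"
  and omega_antimono_on: "antimono_on {0..<1} (\<lambda>r::real. \<omega> (of_real r))"
  and T_tendsto: "(T \<longlongrightarrow> 0) (at_left 1)"
  and deriv_T_tendsto: "((\<lambda>r. deriv T r) \<longlongrightarrow> 0) (at_left 1)"
  and laplacian_pos: "z \<in> unit_disk \<Longrightarrow> laplacian \<phi> z > 0"
  and laplacian_asymp: "\<exists>c>0. \<exists>C>0. \<forall>z\<in>unit_disk.
        c * \<tau> z \<le> laplacian \<phi> z powr (- 1 / 2) \<and> laplacian \<phi> z powr (- 1 / 2) \<le> C * \<tau> z"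
  and C1_phi: "C1_on unit_disk \<phi>" "C1_on unit_disk (dx \<phi>)"
  using class_W unfolding class_W_def radial_def C2_on_def by blast+

lemma T_differentiable: "0 < r \<Longrightarrow> r < 1 \<Longrightarrow> T differentiable (at r)"
  using class_W unfolding class_W_def by simp

lemma T_antimono: "0 \<le> r \<Longrightarrow> r \<le> s \<Longrightarrow> s < 1 \<Longrightarrow> T s \<le> T r"
  using monotone_onD[OF T_antimono_on, of r s] by simp

lemma T_pos: "\<bar>r\<bar> < 1 \<Longrightarrow> T r > 0"
  by (rule tau_pos) auto

lemma Phi_mono:
  assumes "0 \<le> r" "r \<le> s" "s < 1"
  shows "\<Phi> r \<le> \<Phi> s"
proof -
  have "\<omega> (of_real s) \<le> \<omega> (of_real r)"
    using monotone_onD[OF omega_antimono_on, of r s] assms by simp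
  then show ?thesis using assms by (simp add: omega_eq)
qed

lemma C1_on_DERIV_real_axis:
  assumes "C1_on unit_disk u" "\<bar>r\<bar> < 1"
  shows "((\<lambda>r. u (of_real r)) has_real_derivative dx u (of_real r)) (at r)"
proof -
  have "(\<lambda>t::real. u (of_real r + of_real t)) differentiable (at 0)"
    using assms unfolding C1_on_def by force
  then have "((\<lambda>t. u (of_real r + of_real t)) has_real_derivative dx u (of_real r)) (at 0)"
    unfolding dx_def by (simp only: DERIV_deriv_iff_real_differentiable)
  then have "((\<lambda>t. u (of_real (t + r))) has_real_derivative dx u (of_real r)) (at 0)"
    by (simp add: add.commute)
  then show ?thesis
    using DERIV_shift[of "\<lambda>r. u (of_real r)" "dx u (of_real r)" 0 r] by simp
qed

lemmas DERIV_Phi = C1_on_DERIV_real_axis[OF C1_phi(1)]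

lemma radial_deriv_eq: "z \<in> unit_disk \<Longrightarrow> radial_deriv \<phi> z = \<Phi>' (norm z)"
  unfolding radial_deriv_def by (intro DERIV_imp_deriv DERIV_Phi) auto

text \<open>A one-sided argument, since monotonicity is known to the right of \<open>r = 0\<close> only.\<close>
lemma Phi'_nonneg:
  assumes "0 \<le> r" "r < 1"
  shows "\<Phi>' r \<ge> 0"
proof (rule ccontr)
  assume "\<not> \<Phi>' r \<ge> 0"
  then obtain d where d: "d > 0" "\<And>h. 0 < h \<Longrightarrow> h < d \<Longrightarrow> \<Phi> (r + h) < \<Phi> r"
    using DERIV_neg_dec_right[OF DERIV_Phi[of r]] assms by auto
  define h where "h = min (d/2) ((1 - r)/2)"
  have "0 < h" "h < d" "r + h < 1" using d assms by (auto simp: h_def min_def field_simps)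
  then show False using d(2)[of h] Phi_mono[of r "r + h"] assms by force
qed

lemma radial_deriv_nonneg: "z \<in> unit_disk \<Longrightarrow> radial_deriv \<phi> z \<ge> 0"
  by (simp add: radial_deriv_eq Phi'_nonneg)

lemma dy_phi:
  assumes r: "r > 0" and y: "r\<^sup>2 + y\<^sup>2 < 1"
  shows "dy \<phi> (of_real r + \<i> * of_real y) = \<Phi>' (sqrt (r\<^sup>2 + y\<^sup>2)) * (y / sqrt (r\<^sup>2 + y\<^sup>2))"
proof -
  let ?s = "\<lambda>t. sqrt (r\<^sup>2 + (y + t)\<^sup>2)"
  have pos: "r\<^sup>2 + (y + t)\<^sup>2 > 0" for t using r by (simp add: add_pos_nonneg)
  have d: "(?s has_real_derivative (y / sqrt (r\<^sup>2 + y\<^sup>2))) (at 0)"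
    using pos[of 0] by (auto intro!: derivative_eq_intros simp: field_simps)
  have "\<bar>?s 0\<bar> < 1" using y by (simp add: abs_of_nonneg real_sqrt_lt_1_iff)
  then have chain: "((\<lambda>t. \<Phi> (?s t)) has_real_derivative \<Phi>' (sqrt (r\<^sup>2 + y\<^sup>2)) * (y / sqrt (r\<^sup>2 + y\<^sup>2))) (at 0)"
    using DERIV_chain2[OF DERIV_Phi[of "?s 0"] d] by simp
  have "((\<lambda>t. r\<^sup>2 + (y + t)\<^sup>2) \<longlongrightarrow> r\<^sup>2 + (y + 0)\<^sup>2) (at 0)"
    by (intro tendsto_intros)
  then have "\<forall>\<^sub>F t in at 0. r\<^sup>2 + (y + t)\<^sup>2 < 1"
    using y by (intro order_tendstoD) auto
  then have "\<forall>\<^sub>F t in nhds 0. r\<^sup>2 + (y + t)\<^sup>2 < 1"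
    using y by (simp add: eventually_nhds_conv_at)
  then have ev: "\<forall>\<^sub>F t in nhds 0. \<Phi> (?s t) = \<phi> ((of_real r + \<i> * of_real y) + \<i> * of_real t)"
  proof eventually_elim
    case (elim t)
    have n: "norm ((of_real r + \<i> * of_real y) + \<i> * of_real t) = ?s t"
      by (simp add: cmod_def)
    have "\<phi> ((of_real r + \<i> * of_real y) + \<i> * of_real t) = \<Phi> (norm ((of_real r + \<i> * of_real y) + \<i> * of_real t))"
      by (rule phi_radial) (simp only: mem_ball dist_0_norm n real_sqrt_lt_1_iff elim)
    then show ?case unfolding n by simp
  qed
  have "((\<lambda>t. \<phi> ((of_real r + \<i> * of_real y) + \<i> * of_real t)) has_real_derivative
      \<Phi>' (sqrt (r\<^sup>2 + y\<^sup>2)) * (y / sqrt (r\<^sup>2 + y\<^sup>2))) (at 0)"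
    by (rule DERIV_cong_ev[OF refl ev refl, THEN iffD1, OF chain])
  then show ?thesis unfolding dy_def by (rule DERIV_imp_deriv)
qed

text \<open>On the vertical line through \<open>r\<close> the first derivative is \<open>y \<cdot> \<Phi>'(s)/s\<close> with \<open>s\<close> the modulus; the
  factor of \<open>y\<close> is continuous, so its value at \<open>y = 0\<close> is the second derivative.\<close>
lemma dy_dy_phi:
  assumes r: "0 < r" "r < 1"
  shows "dy (dy \<phi>) (of_real r) = \<Phi>' r / r"
proof -
  let ?s = "\<lambda>y. sqrt (r\<^sup>2 + y\<^sup>2)"
  have cont: "isCont (\<lambda>y. \<Phi>' (?s y) / ?s y) 0"
  proof -
    have "isCont \<Phi>' r"
      using C1_on_DERIV_real_axis[OF C1_phi(2), of r] r DERIV_isCont by auto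
    then have "isCont \<Phi>' (?s 0)" using r by simp
    then have "isCont (\<lambda>y. \<Phi>' (?s y)) 0"
      by (intro isCont_o2[where f = ?s and g = \<Phi>'] continuous_intros)
    then show ?thesis using r by (intro continuous_intros) auto
  qed
  have chain: "((\<lambda>y. \<Phi>' (?s y) * (y / ?s y)) has_real_derivative \<Phi>' r / r) (at 0)"
    unfolding CARAT_DERIV using cont r
    by (intro exI[of _ "\<lambda>y. \<Phi>' (?s y) / ?s y"]) auto
  have "((\<lambda>y. r\<^sup>2 + y\<^sup>2) \<longlongrightarrow> r\<^sup>2 + 0\<^sup>2) (at 0)"
    by (intro tendsto_intros)
  moreover have "r\<^sup>2 < 1" using r by (simp add: power_less_one_iff)
  ultimately have "\<forall>\<^sub>F y in nhds 0. r\<^sup>2 + y\<^sup>2 < 1"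
    by (simp add: eventually_nhds_conv_at order_tendstoD)
  then have ev: "\<forall>\<^sub>F y in nhds 0. \<Phi>' (?s y) * (y / ?s y) = dy \<phi> (of_real r + \<i> * of_real y)"
    by eventually_elim (use dy_phi r in simp)
  have "((\<lambda>y. dy \<phi> (of_real r + \<i> * of_real y)) has_real_derivative \<Phi>' r / r) (at 0)"
    by (rule DERIV_cong_ev[OF refl ev refl, THEN iffD1, OF chain])
  then show ?thesis unfolding dy_def[of "dy \<phi>"] by (rule DERIV_imp_deriv)
qed

text \<open>The Laplacian in polar coordinates: \<open>(r \<Phi>')' = r \<Delta>\<phi>\<close>.\<close>
lemma DERIV_flux:
  assumes r: "0 < r" "r < 1"
  shows "(flux has_real_derivative r * laplacian \<phi> (of_real r)) (at r)"
  using r by (auto intro!: derivative_eq_intros C1_on_DERIV_real_axis[OF C1_phi(2)]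
                   simp: laplacian_def dy_dy_phi field_simps)

lemma laplacian_bounds:
  obtains k K where "0 < k" "0 < K"
    "\<And>r. 0 \<le> r \<Longrightarrow> r < 1 \<Longrightarrow> k / (T r)\<^sup>2 \<le> laplacian \<phi> (of_real r)"
    "\<And>r. 0 \<le> r \<Longrightarrow> r < 1 \<Longrightarrow> laplacian \<phi> (of_real r) \<le> K / (T r)\<^sup>2"
proof -
  obtain c C where cC: "c > 0" "C > 0" and
    bd: "\<And>z. z \<in> unit_disk \<Longrightarrow> c * \<tau> z \<le> laplacian \<phi> z powr (- 1 / 2)"
        "\<And>z. z \<in> unit_disk \<Longrightarrow> laplacian \<phi> z powr (- 1 / 2) \<le> C * \<tau> z"
    using laplacian_asymp by blast
  note pos = laplacian_pos
  have sq: "1 / laplacian \<phi> z = (laplacian \<phi> z powr (- 1 / 2))\<^sup>2" if "z \<in> unit_disk" for z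
  proof -
    have "(laplacian \<phi> z powr (- 1 / 2))\<^sup>2 = laplacian \<phi> z powr (- 1 / 2 + - 1 / 2)"
      by (simp only: power2_eq_square powr_add)
    also have "\<dots> = laplacian \<phi> z powr (- 1)" by simp
    also have "\<dots> = 1 / laplacian \<phi> z" using pos[OF that] by (simp only: powr_minus_divide powr_one)
    finally show ?thesis by simp
  qed
  show ?thesis
  proof (rule that[of "1 / C\<^sup>2" "1 / c\<^sup>2"])
    fix r :: real assume r: "0 \<le> r" "r < 1"
    then have z: "complex_of_real r \<in> unit_disk" by simp
    have t: "T r > 0" using tau_pos[OF z] .
    have "(c * T r)\<^sup>2 \<le> 1 / laplacian \<phi> (of_real r)"
      unfolding sq[OF z] using bd(1)[OF z] t cC by (intro power_mono) auto
    then show "laplacian \<phi> (of_real r) \<le> 1 / c\<^sup>2 / (T r)\<^sup>2"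
      using pos[OF z] t cC by (simp add: field_simps)
    have "1 / laplacian \<phi> (of_real r) \<le> (C * T r)\<^sup>2"
      unfolding sq[OF z] using bd(2)[OF z] by (intro power_mono) auto
    then show "1 / C\<^sup>2 / (T r)\<^sup>2 \<le> laplacian \<phi> (of_real r)"
      using pos[OF z] t cC by (simp add: field_simps)
  qed (use cC in auto)
qed

text \<open>Integrating \<open>\<tau>' \<rightarrow> 0\<close>; the second bound is the limit \<open>s \<rightarrow> 1\<close> of the first.\<close>
lemma T_lipschitz_near_one:
  obtains r0 where "1/2 \<le> r0" "r0 < 1"
    "\<And>r s. r0 \<le> r \<Longrightarrow> r \<le> s \<Longrightarrow> s < 1 \<Longrightarrow> T r - T s \<le> (s - r) / 2"
    "\<And>r. r0 \<le> r \<Longrightarrow> r < 1 \<Longrightarrow> T r \<le> (1 - r) / 2"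
proof -
  have "\<forall>\<^sub>F r in at_left 1. deriv T r > - (1/2)"
    using deriv_T_tendsto by (intro order_tendstoD) auto
  then obtain b where b: "b < 1" "\<And>r. b < r \<Longrightarrow> r < 1 \<Longrightarrow> deriv T r > - (1/2)"
    unfolding eventually_at_left_field by auto
  define r0 where "r0 = max (1/2) ((1 + b)/2)"
  have r0: "1/2 \<le> r0" "r0 < 1" "b < r0" using b by (auto simp: r0_def max_def)
  have lip: "T r - T s \<le> (s - r) / 2" if rs: "r0 \<le> r" "r \<le> s" "s < 1" for r s
  proof (cases "r = s")
    case False
    then have "r < s" using rs by simp
    then have "\<exists>x. r < x \<and> x < s \<and> T s - T r = (s - r) * deriv T x"
    proof (rule MVT2)
      fix x assume "r \<le> x" "x \<le> s"
      then have "T differentiable (at x)" using rs r0 by (intro T_differentiable) auto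
      then show "(T has_real_derivative deriv T x) (at x)"
        by (simp only: DERIV_deriv_iff_real_differentiable)
    qed
    then obtain x where x: "r < x" "x < s" "T s - T r = (s - r) * deriv T x" by blast
    have "(s - r) * deriv T x \<ge> (s - r) * (- (1/2))"
      using x rs r0 b(2)[of x] by (intro mult_left_mono) auto
    then have "- ((s - r) / 2) \<le> T s - T r" unfolding x(3) by simp
    then show ?thesis by linarith
  qed auto
  moreover have "T r \<le> (1 - r) / 2" if r: "r0 \<le> r" "r < 1" for r
  proof -
    have ev: "\<forall>\<^sub>F s in at_left 1. T r - T s \<le> (s - r) / 2"
      unfolding eventually_at_left_field using lip r by (intro exI[of _ r]) auto
    have l1: "((\<lambda>s. T r - T s) \<longlongrightarrow> T r - 0) (at_left 1)"
      by (intro tendsto_intros T_tendsto)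
    have l2: "((\<lambda>s. (s - r) / 2) \<longlongrightarrow> (1 - r) / 2) (at_left 1)"
      by (intro tendsto_intros) auto
    show ?thesis
      using tendsto_le[OF trivial_limit_at_left_real l2 l1 ev] by simp
  qed
  ultimately show ?thesis using that r0 by blast
qed

text \<open>The scale \<open>\<delta> \<tau>(a)\<close> at which the geometry is uniform: disks of this radius stay well inside the unit
  disk, and \<open>\<tau>\<close> does not drop by more than a constant factor on them. Near the boundary this is the
  Lipschitz bound. Away from it \<open>\<tau>\<close> lies between two positive constants, with no modulus
  of continuity, so \<open>\<delta>\<close> is chosen to keep these disks within a fixed smaller disk.\<close>
lemma tau_disk_radius:
  obtains \<delta> \<kappa> where "0 < \<delta>" "0 < \<kappa>"
    "\<And>a. 0 \<le> a \<Longrightarrow> a < 1 \<Longrightarrow> \<delta> * T a \<le> (1 - a) / 2"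
    "\<And>a. 0 \<le> a \<Longrightarrow> a < 1 \<Longrightarrow> \<delta> * T a \<le> 1 / 4"
    "\<And>a r. 0 \<le> a \<Longrightarrow> a < 1 \<Longrightarrow> a \<le> r \<Longrightarrow> r \<le> a + \<delta> * T a \<Longrightarrow> \<kappa> * T a \<le> T r"
proof -
  obtain r0 where r0: "1/2 \<le> r0" "r0 < 1"
    and lip: "\<And>r s. r0 \<le> r \<Longrightarrow> r \<le> s \<Longrightarrow> s < 1 \<Longrightarrow> T r - T s \<le> (s - r) / 2"
    and small: "\<And>r. r0 \<le> r \<Longrightarrow> r < 1 \<Longrightarrow> T r \<le> (1 - r) / 2"
    using T_lipschitz_near_one by blast
  define r1 where "r1 = (1 + r0) / 2"
  have r1: "r0 < r1" "r1 < 1" using r0 by (auto simp: r1_def)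
  have T0: "T 0 > 0" and T1: "T r1 > 0" using T_pos[of 0] T_pos[of r1] r1 r0 by auto
  define \<delta> where "\<delta> = Min {1, (1 - r0) / (2 * T 0), 1 / (4 * T 0)}"
  define \<kappa> where "\<kappa> = min (1/2) (T r1 / T 0)"
  have \<delta>: "0 < \<delta>" "\<delta> \<le> 1" "\<delta> \<le> (1 - r0) / (2 * T 0)" "\<delta> \<le> 1 / (4 * T 0)"
    using r0 T0 by (auto simp: \<delta>_def)
  have d0: "\<delta> * T 0 \<le> (1 - r0) / 2" "\<delta> * T 0 \<le> 1 / 4"
    using \<delta> T0 by (auto simp: field_simps)
  have le0: "\<delta> * T a \<le> \<delta> * T 0" if "0 \<le> a" "a < 1" for a
    using T_antimono[of 0 a] that \<delta> by (intro mult_left_mono) auto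
  show ?thesis
  proof (rule that[of \<delta> \<kappa>])
    fix a :: real assume a: "0 \<le> a" "a < 1"
    show "\<delta> * T a \<le> 1 / 4" using le0[OF a] d0 by simp
    show "\<delta> * T a \<le> (1 - a) / 2"
    proof (cases "a \<le> r0")
      case True then show ?thesis using le0[OF a] d0 by simp
    next
      case False
      have "\<delta> * T a \<le> 1 * T a" using \<delta> T_pos[of a] a by (intro mult_right_mono) auto
      then show ?thesis using small[of a] False a by simp
    qed
  next
    fix a r :: real assume ar: "0 \<le> a" "a < 1" "a \<le> r" "r \<le> a + \<delta> * T a"
    show "\<kappa> * T a \<le> T r"
    proof (cases "a \<le> r0")
      case True
      have "a + \<delta> * T a \<le> r1" using le0[of a] d0 ar True r0 by (simp add: r1_def)
      then have "T r1 \<le> T r" using T_antimono[of r r1] ar r1 by auto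
      have "\<kappa> * T a \<le> (T r1 / T 0) * T 0" using T_antimono[of 0 a] T_pos[of a] True r0 ar T0 T1 by (intro mult_mono) (auto simp: \<kappa>_def)
      then show ?thesis using \<open>T r1 \<le> T r\<close> T0 by simp
    next
      case False
      have ta: "\<delta> * T a \<le> T a"
        using \<delta> T_pos[of a] ar by (simp add: mult_le_cancel_right1)
      have "r < 1" using small[of a] ta False ar by auto
      then have "T a - T r \<le> T a / 2" using lip[of a r] False ar ta by auto
      moreover have "\<kappa> * T a \<le> (1/2) * T a"
        unfolding \<kappa>_def using T_pos[of a] ar by (intro mult_right_mono min.cobounded1) auto
      ultimately show ?thesis by simp
    qed
  qed (use \<delta> T0 T1 in \<open>auto simp: \<kappa>_def\<close>)
qed

text \<open>On \<open>[a - \<tau>(a), a]\<close>, near the boundary, \<open>\<tau>\<close> is comparable to \<open>\<tau>(a)\<close>, so the flux grows there at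
  rate \<open>1/\<tau>(a)^2\<close> over a length \<open>\<tau>(a)\<close>.\<close>
lemma inverse_tau_le_deriv:
  obtains C where "0 < C" "\<And>a. 0 \<le> a \<Longrightarrow> a < 1 \<Longrightarrow> 1 / T a \<le> C * (1 + \<Phi>' a)"
proof -
  obtain r0 where r0: "1/2 \<le> r0" "r0 < 1"
    and lip: "\<And>r s. r0 \<le> r \<Longrightarrow> r \<le> s \<Longrightarrow> s < 1 \<Longrightarrow> T r - T s \<le> (s - r) / 2"
    and small: "\<And>r. r0 \<le> r \<Longrightarrow> r < 1 \<Longrightarrow> T r \<le> (1 - r) / 2"
    using T_lipschitz_near_one by blast
  obtain k K where k: "0 < k" "0 < K"
    and lap: "\<And>r. 0 \<le> r \<Longrightarrow> r < 1 \<Longrightarrow> k / (T r)\<^sup>2 \<le> laplacian \<phi> (of_real r)"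
      "\<And>r. 0 \<le> r \<Longrightarrow> r < 1 \<Longrightarrow> laplacian \<phi> (of_real r) \<le> K / (T r)\<^sup>2"
    using laplacian_bounds by blast
  define r2 where "r2 = (1 + 2 * r0) / 3"
  have r2: "r0 < r2" "r2 < 1" using r0 by (auto simp: r2_def)
  have T2: "T r2 > 0" using T_pos[of r2] r2 r0 by auto
  define C where "C = max (1 / T r2) (8 / k)"
  have C: "C > 0" "1 / T r2 \<le> C" "8 / k \<le> C" using T2 by (auto simp: C_def less_max_iff_disj)
  have "1 / T a \<le> C * (1 + \<Phi>' a)" if a: "0 \<le> a" "a < 1" for a
  proof (cases "a \<le> r2")
    case True
    have "1 / T a \<le> 1 / T r2" using T2 T_antimono[of a r2] a True r2 by (intro divide_left_mono) auto
    also have "\<dots> \<le> C * 1" using C by simp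
    also have "\<dots> \<le> C * (1 + \<Phi>' a)" using C Phi'_nonneg[OF a] by (intro mult_left_mono) auto
    finally show ?thesis .
  next
    case False
    have t: "T a > 0" using T_pos a by auto
    define b where "b = a - T a"
    have ba: "b < a" using t by (simp add: b_def)
    have b: "r0 \<le> b" using small[of a] False a r2 by (simp add: b_def r2_def)
    have "\<exists>x. b < x \<and> x < a \<and> flux a - flux b = (a - b) * (x * laplacian \<phi> (of_real x))"
    proof (rule MVT2[OF ba])
      fix x assume "b \<le> x" "x \<le> a"
      then show "(flux has_real_derivative x * laplacian \<phi> (of_real x)) (at x)"
        using b r0 a by (intro DERIV_flux) auto
    qed
    then obtain x where x: "b < x" "x < a" "flux a - flux b = (a - b) * (x * laplacian \<phi> (of_real x))"
      by blast
    have tx: "T x > 0" "T x \<le> 2 * T a"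
      using T_pos[of x] lip[of x a] x b r0 a by (auto simp: b_def)
    have "k / (2 * T a)\<^sup>2 \<le> k / (T x)\<^sup>2"
      using tx t k by (intro divide_left_mono power_mono) auto
    also have "\<dots> \<le> laplacian \<phi> (of_real x)" using lap(1)[of x] x b r0 a by auto
    finally have l: "k / (2 * T a)\<^sup>2 \<le> laplacian \<phi> (of_real x)" .
    have "(1/2) * (k / (2 * T a)\<^sup>2) \<le> x * laplacian \<phi> (of_real x)"
      using l x b r0 k by (intro mult_mono) auto
    then have "T a * ((1/2) * (k / (2 * T a)\<^sup>2)) \<le> T a * (x * laplacian \<phi> (of_real x))"
      using t by (intro mult_left_mono) auto
    then have "T a * ((1/2) * (k / (2 * T a)\<^sup>2)) \<le> flux a - flux b"
      unfolding x(3) by (simp add: b_def)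
    moreover have "flux b \<ge> 0" using Phi'_nonneg[of b] b r0 ba a by auto
    moreover have "flux a \<le> 1 * \<Phi>' a" using a Phi'_nonneg[of a] by (intro mult_right_mono) auto
    moreover have "T a * ((1/2) * (k / (2 * T a)\<^sup>2)) = k / 8 * (1 / T a)"
      using t by (simp add: field_simps power2_eq_square)
    ultimately have "k / 8 * (1 / T a) \<le> \<Phi>' a" by linarith
    then have "1 / T a \<le> 8 / k * \<Phi>' a" using k by (simp add: field_simps)
    also have "\<dots> \<le> C * (1 + \<Phi>' a)"
      using C Phi'_nonneg[OF a] k by (intro mult_mono) auto
    finally show ?thesis .
  qed
  with C show ?thesis using that by blast
qed

section \<open>Growth of the weight relative to a logarithm\<close>

text \<open>The gap between \<open>\<phi>\<close> and its tangent in the variable \<open>log r\<close> at \<open>a\<close>. The tangent is the real part of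
  a holomorphic logarithm and corresponds to the monomial of degree \<open>flux a\<close>.\<close>
definition excess :: "real \<Rightarrow> real \<Rightarrow> real" where
  "excess a r = \<Phi> r - \<Phi> a - flux a * ln (r / a)"

lemma DERIV_excess:
  assumes "0 < a" "0 < r" "r < 1"
  shows "(excess a has_real_derivative (flux r - flux a) / r) (at r)"
  unfolding excess_def[abs_def] using assms
  by (auto intro!: derivative_eq_intros DERIV_Phi simp: field_simps)

lemma excess_self [simp]: "0 < a \<Longrightarrow> excess a a = 0"
  by (simp add: excess_def)

lemma flux_increment:
  assumes "0 < r" "r < s" "s < 1"
  obtains x where "r < x" "x < s" "flux s - flux r = (s - r) * (x * laplacian \<phi> (of_real x))"
proof -
  have "\<exists>x. r < x \<and> x < s \<and> flux s - flux r = (s - r) * (x * laplacian \<phi> (of_real x))"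
    by (rule MVT2[OF \<open>r < s\<close>]) (use assms in \<open>auto intro!: DERIV_flux\<close>)
  with that show ?thesis by blast
qed

lemma flux_mono:
  assumes "0 < r" "r \<le> s" "s < 1"
  shows "flux r \<le> flux s"
proof (cases "r = s")
  case False
  then obtain x where "r < x" "x < s" "flux s - flux r = (s - r) * (x * laplacian \<phi> (of_real x))"
    using flux_increment[of r s] assms by auto
  moreover from this have "0 \<le> (s - r) * (x * laplacian \<phi> (of_real x))"
    using assms laplacian_pos[of "of_real x"] by (intro mult_nonneg_nonneg) auto
  ultimately show ?thesis by simp
qed auto

text \<open>Convexity of \<open>\<phi>\<close> in \<open>log r\<close>.\<close>
lemma excess_nonneg_inside:
  assumes "0 < r" "r \<le> a" "a < 1"
  shows "0 \<le> excess a r"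
proof -
  have "excess a a \<le> excess a r"
  proof (rule DERIV_nonpos_imp_nonincreasing[OF \<open>r \<le> a\<close>])
    fix x assume x: "r \<le> x" "x \<le> a"
    then show "\<exists>y. (excess a has_real_derivative y) (at x) \<and> y \<le> 0"
      using DERIV_excess[of a x] flux_mono[of x a] assms
      by (intro exI[of _ "(flux x - flux a) / x"]) (auto simp: divide_nonpos_pos)
  qed
  then show ?thesis using assms by simp
qed

text \<open>As \<open>\<tau>\<close> decreases, the lower bound \<open>k/\<tau>(a)^2\<close> for the Laplacian at \<open>a\<close> persists at all larger
  radii; integrating twice gives the quadratic growth.\<close>
lemma excess_quadratic_outside:
  obtains c where "0 < c"
    "\<And>a r. 1/2 \<le> a \<Longrightarrow> a \<le> r \<Longrightarrow> r < 1 \<Longrightarrow> c * ((r - a) / T a)\<^sup>2 \<le> excess a r"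
proof -
  obtain k K where k: "0 < k" "0 < K"
    and lap: "\<And>r. 0 \<le> r \<Longrightarrow> r < 1 \<Longrightarrow> k / (T r)\<^sup>2 \<le> laplacian \<phi> (of_real r)"
      "\<And>r. 0 \<le> r \<Longrightarrow> r < 1 \<Longrightarrow> laplacian \<phi> (of_real r) \<le> K / (T r)\<^sup>2"
    using laplacian_bounds by blast
  have "k / 4 * ((r - a) / T a)\<^sup>2 \<le> excess a r" if a: "1/2 \<le> a" "a \<le> r" "r < 1" for a r
  proof -
    have t: "T a > 0" using a T_pos[of a] by auto
    have lower: "k / (2 * (T a)\<^sup>2) * (x - a) \<le> (flux x - flux a) / x" if x: "a \<le> x" "x \<le> r" for x
    proof (cases "x = a")
      case False
      obtain y where y: "a < y" "y < x" "flux x - flux a = (x - a) * (y * laplacian \<phi> (of_real y))"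
        using flux_increment[of a x] False x a by auto
      have ty: "0 < T y" "T y \<le> T a" using T_pos[of y] T_antimono[of a y] y x a by auto
      have "k / (T a)\<^sup>2 \<le> k / (T y)\<^sup>2"
        using ty t k by (intro divide_left_mono power_mono) auto
      also have "\<dots> \<le> laplacian \<phi> (of_real y)" using lap(1)[of y] y x a by auto
      finally have "(1/2) * (k / (T a)\<^sup>2) \<le> y * laplacian \<phi> (of_real y)"
        using y a k by (intro mult_mono) auto
      then have "(x - a) * ((1/2) * (k / (T a)\<^sup>2)) \<le> flux x - flux a"
        unfolding y(3) using x by (intro mult_left_mono) auto
      also have "\<dots> \<le> (flux x - flux a) / x"
      proof -
        have "(flux x - flux a) * x \<le> (flux x - flux a) * 1"
          using flux_mono[of a x] x a by (intro mult_left_mono) auto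
        then show ?thesis using x a by (simp add: pos_le_divide_eq)
      qed
      finally show ?thesis by (simp add: field_simps)
    qed auto
    let ?h = "\<lambda>x. excess a x - k / 4 * ((x - a) / T a)\<^sup>2"
    have "?h a \<le> ?h r"
    proof (rule DERIV_nonneg_imp_nondecreasing[OF \<open>a \<le> r\<close>])
      fix x assume x: "a \<le> x" "x \<le> r"
      have "(?h has_real_derivative (flux x - flux a) / x - k / (2 * (T a)\<^sup>2) * (x - a)) (at x)"
        using x a t
        by (auto intro!: derivative_eq_intros DERIV_excess simp: power2_eq_square field_simps)
      then show "\<exists>y. (?h has_real_derivative y) (at x) \<and> 0 \<le> y"
        using lower[OF x] by (intro exI conjI) auto
    qed
    then show ?thesis using a by simp
  qed
  then show ?thesis using that[of "k / 4"] k by simp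
qed

text \<open>In the product of \<open>peak\<close> with \<open>exp (\<phi>(a) - \<phi>(z))\<close> the exponents add up to \<open>- excess\<close>, plus the
  error from rounding the degree up, plus the growth of the averages. Inside the circle
  rounding up helps and the averages do not grow. Outside, with \<open>x = (r - \<bar>a\<bar>)/\<tau>(a)\<close>, the error terms are
  at most \<open>B x\<close> and the excess is at least \<open>c x^2\<close>, so the sum is bounded by \<open>B^2/(4 c)\<close>.\<close>
lemma weighted_peak_bound:
  obtains K where "0 < K"
    "\<And>a z. 1/2 \<le> norm a \<Longrightarrow> norm a < 1 \<Longrightarrow> norm z < 1 \<Longrightarrow>
       norm (peak (Suc (nat \<lceil>flux (norm a)\<rceil>)) (nat \<lceil>1 / \<tau> a\<rceil>) k (z / a)) * exp (\<phi> a - \<phi> z)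
         \<le> K * (\<tau> a / (\<tau> a + norm (z - a))) ^ k"
proof -
  obtain c where c: "c > 0"
    and quad: "\<And>a r. 1/2 \<le> a \<Longrightarrow> a \<le> r \<Longrightarrow> r < 1 \<Longrightarrow> c * ((r - a) / T a)\<^sup>2 \<le> excess a r"
    using excess_quadratic_outside by blast
  define B where "B = 2 * T 0 * (2 + k) + 2 * k"
  have T0: "T 0 > 0" using T_pos[of 0] by simp
  have bound: "norm (peak (Suc (nat \<lceil>flux (norm a)\<rceil>)) (nat \<lceil>1 / \<tau> a\<rceil>) k (z / a)) * exp (\<phi> a - \<phi> z)
         \<le> 3 ^ k * exp (B\<^sup>2 / (4 * c)) * (\<tau> a / (\<tau> a + norm (z - a))) ^ k"
    if a: "1/2 \<le> norm a" "norm a < 1" and z: "norm z < 1" for a z :: complex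
  proof (cases "z = 0")
    case True
    have "\<tau> a > 0" using tau_pos a by auto
    then show ?thesis using True by (simp add: peak_def)
  next
    case False
    define \<alpha> r t where "\<alpha> = norm a" and "r = norm z" and "t = T \<alpha>"
    define N m where "N = Suc (nat \<lceil>flux \<alpha>\<rceil>)" and "m = nat \<lceil>1 / t\<rceil>"
    define L where "L = ln (r / \<alpha>)"
    have \<alpha>: "1/2 \<le> \<alpha>" "\<alpha> < 1" and r: "0 < r" "r < 1"
      using a z False by (auto simp: \<alpha>_def r_def)
    have ta: "\<tau> a = t" using a tau_radial[of a] by (simp add: t_def \<alpha>_def)
    have t: "0 < t" "t \<le> T 0"
      using T_pos[of \<alpha>] T_antimono[of 0 \<alpha>] \<alpha> by (auto simp: t_def)
    have m: "m > 0" "1 / t \<le> m" "m \<le> 1 / t + 1"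
      using t by (auto simp: m_def)
    have fl: "flux \<alpha> \<ge> 0" using Phi'_nonneg[of \<alpha>] \<alpha> by auto
    have N: "flux \<alpha> \<le> N" "N \<le> flux \<alpha> + 2"
      using fl unfolding N_def by linarith+
    have "0 < r / \<alpha>" using r \<alpha> by simp
    then have w: "norm (z / a) = exp L"
      unfolding L_def by (simp add: norm_divide \<alpha>_def r_def)
    have phi: "\<phi> a - \<phi> z = - (excess \<alpha> r + flux \<alpha> * L)"
      using a z phi_radial[of a] phi_radial[of z] by (simp add: excess_def L_def \<alpha>_def r_def)
    have dist: "norm (z - a) / t \<le> m * norm (z / a - 1)"
    proof -
      have "norm (z / a - 1) = norm (z - a) / \<alpha>"
        using \<alpha> by (auto simp: \<alpha>_def norm_divide[symmetric] diff_divide_distrib)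
      then have "norm (z - a) \<le> norm (z / a - 1)"
        using \<alpha> by (simp add: pos_le_divide_eq mult_left_le)
      then show ?thesis
        using mult_mono[OF m(2), of "norm (z - a)" "norm (z / a - 1)"] by simp
    qed
    have D: "norm ((\<Sum>j<m. (z/a) ^ j) / of_nat m) \<le> 3 * exp (m * max 0 L) * (t / (t + norm (z - a)))"
    proof -
      have "max 1 (norm (z / a)) ^ m = exp (m * max 0 L)"
        unfolding w by (auto simp: max_def exp_of_nat_mult)
      then have "norm ((\<Sum>j<m. (z/a) ^ j) / of_nat m) \<le> 3 * exp (m * max 0 L) / (1 + m * norm (z / a - 1))"
        using norm_geometric_average_le[OF m(1), of "z / a"] by simp
      also have "\<dots> \<le> 3 * exp (m * max 0 L) / (1 + norm (z - a) / t)"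
        using dist t by (intro divide_left_mono mult_pos_pos add_pos_nonneg) auto
      also have "\<dots> = 3 * exp (m * max 0 L) * (t / (t + norm (z - a)))"
        using t by (simp add: field_simps)
      finally show ?thesis .
    qed
    have expo: "N * L + k * (m * max 0 L) - (excess \<alpha> r + flux \<alpha> * L) \<le> B\<^sup>2 / (4 * c)"
    proof (cases "r \<le> \<alpha>")
      case True
      then have "L \<le> 0" using r \<alpha> by (simp add: L_def)
      then have "(N - flux \<alpha>) * L \<le> 0" using N by (simp add: mult_nonneg_nonpos)
      moreover have "0 \<le> excess \<alpha> r" using True r \<alpha> by (intro excess_nonneg_inside) auto
      moreover have "0 \<le> B\<^sup>2 / (4 * c)" using c by simp
      moreover have "max 0 L = 0" using \<open>L \<le> 0\<close> by simp
      ultimately show ?thesis by (simp add: left_diff_distrib)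
    next
      case False
      define x where "x = (r - \<alpha>) / t"
      have x: "x \<ge> 0" using False t by (simp add: x_def)
      have L0: "0 \<le> L" using False \<alpha> by (simp add: L_def)
      have "L \<le> r / \<alpha> - 1" unfolding L_def using r \<alpha> by (intro ln_le_minus_one) auto
      also have "\<dots> = (r - \<alpha>) / \<alpha>" using \<alpha> by (simp add: diff_divide_distrib)
      also have "\<dots> \<le> (r - \<alpha>) / (1/2)" using False \<alpha> by (intro divide_left_mono) auto
      finally have L1: "L \<le> 2 * t * x" using t by (simp add: x_def)
      have "(N - flux \<alpha>) * L + k * (m * L) = (N - flux \<alpha> + k * m) * L" by (simp add: algebra_simps)
      also have "\<dots> \<le> (2 + k * (1 / t + 1)) * (2 * t * x)"
        using L0 L1 N m t by (intro mult_mono add_mono) (auto intro: mult_left_mono)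
      also have "\<dots> = (2 * t * (2 + k) + 2 * k) * x"
        using t by (simp add: field_simps)
      also have "\<dots> \<le> B * x"
        unfolding B_def using t x by (intro mult_right_mono add_mono) auto
      also have "\<dots> \<le> c * x\<^sup>2 + B\<^sup>2 / (4 * c)"
      proof -
        have "0 \<le> (2 * c * x - B)\<^sup>2 / (4 * c)" using c by simp
        also have "\<dots> = c * x\<^sup>2 + B\<^sup>2 / (4 * c) - B * x"
          using c by (simp add: power2_eq_square field_simps)
        finally show ?thesis by simp
      qed
      also have "c * x\<^sup>2 \<le> excess \<alpha> r"
        using quad[of \<alpha> r] False \<alpha> r by (simp add: x_def t_def)
      finally show ?thesis using L0 by (simp add: algebra_simps)
    qed
    have "norm (peak N m k (z / a)) * exp (\<phi> a - \<phi> z)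
        = exp (N * L) * norm ((\<Sum>j<m. (z/a) ^ j) / of_nat m) ^ k * exp (- (excess \<alpha> r + flux \<alpha> * L))"
      unfolding peak_def norm_mult norm_power w phi by (simp add: exp_of_nat_mult)
    also have "\<dots> \<le> exp (N * L) * (3 * exp (m * max 0 L) * (t / (t + norm (z - a)))) ^ k * exp (- (excess \<alpha> r + flux \<alpha> * L))"
      using D by (intro mult_right_mono mult_left_mono power_mono) auto
    also have "\<dots> = 3 ^ k * exp (N * L + k * (m * max 0 L) - (excess \<alpha> r + flux \<alpha> * L)) * (t / (t + norm (z - a))) ^ k"
      by (simp only: power_mult_distrib exp_of_nat_mult[of k "m * max 0 L", symmetric] exp_add exp_diff exp_minus divide_inverse mult_ac)
    also have "\<dots> \<le> 3 ^ k * exp (B\<^sup>2 / (4 * c)) * (t / (t + norm (z - a))) ^ k"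
      using expo t by (intro mult_right_mono mult_left_mono) auto
    finally show ?thesis unfolding N_def m_def ta \<alpha>_def .
  qed
  show ?thesis by (rule that[OF _ bound]) auto
qed

section \<open>Test functions of bounded norm\<close>

lemma phi_continuous: "continuous_on unit_disk \<phi>"
proof -
  have "continuous_on {-1<..<1} \<Phi>"
    by (rule DERIV_continuous_on, rule has_field_derivative_at_within, rule DERIV_Phi) auto
  then have "continuous_on unit_disk (\<lambda>z. \<Phi> (norm z))"
  proof (rule continuous_on_compose2[where f = norm])
    have "-1 < norm z" for z :: complex by (rule less_le_trans[OF _ norm_ge_zero]) simp
    then show "norm ` unit_disk \<subseteq> {-1<..<1}" by auto
  qed (intro continuous_intros)
  then show ?thesis
    by (rule continuous_on_eq) (rule phi_radial[symmetric])
qed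

lemma weighted_power_eq:
  assumes "z \<in> unit_disk"
  shows "norm (f z) powr p * \<omega> z powr (p / 2) = (norm (f z) * exp (- \<phi> z)) powr p"
proof -
  have "\<omega> z powr (p / 2) = exp (- \<phi> z) powr p"
    using omega_eq[OF assms] by (simp add: powr_def)
  then show ?thesis by (simp add: powr_mult)
qed

lemma weighted_power_measurable:
  assumes "f holomorphic_on unit_disk"
  shows "(\<lambda>z. norm (f z) powr p * \<omega> z powr (p / 2)) \<in> borel_measurable area"
proof -
  have f: "f \<in> borel_measurable area"
    by (rule borel_measurable_area_continuous) (rule holomorphic_on_imp_continuous_on[OF assms])
  have ph: "\<phi> \<in> borel_measurable area"
    by (rule borel_measurable_area_continuous[OF phi_continuous])
  from f ph have "(\<lambda>z. (norm (f z) * exp (- \<phi> z)) powr p) \<in> borel_measurable area"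
    by measurable
  then show ?thesis
    by (rule measurable_cong[THEN iffD2, rotated]) (simp add: weighted_power_eq)
qed

lemma in_bergman_of_bounded:
  assumes p: "p > 0" and f: "f holomorphic_on unit_disk"
    and bd: "\<And>z. z \<in> unit_disk \<Longrightarrow> norm (f z) * exp (- \<phi> z) \<le> B"
  shows "f \<in> bergman p \<omega>" "bergman_norm p \<omega> f \<le> B"
proof -
  have B: "B \<ge> 0" using bd[of 0] by (meson centre_in_ball mult_nonneg_nonneg norm_ge_zero exp_ge_zero order_trans zero_less_one)
  let ?g = "\<lambda>z. norm (f z) powr p * \<omega> z powr (p / 2)"
  interpret finite_measure area by (rule finite_measure_area)
  have le: "?g z \<le> B powr p" if "z \<in> unit_disk" for z
    unfolding weighted_power_eq[OF that] using bd[OF that] p by (intro powr_mono2) auto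
  have int: "integrable area ?g"
    using le by (intro integrable_const_bound[of _ "B powr p"] AE_I2 weighted_power_measurable f) auto
  then show "f \<in> bergman p \<omega>" using f by (simp add: bergman_def)
  have m1: "measure area unit_disk = 1"
    using emeasure_area_ball[of 0 1] by (simp add: measure_def)
  have "integral\<^sup>L area ?g \<le> (\<integral>z. B powr p \<partial>area)"
    using le int by (intro integral_mono) auto
  also have "\<dots> = B powr p" using m1 by simp
  finally have "integral\<^sup>L area ?g powr (1 / p) \<le> (B powr p) powr (1 / p)"
    using p by (intro powr_mono2 integral_nonneg_AE) auto
  also have "\<dots> = B" using p B by (simp add: powr_powr)
  finally show "bergman_norm p \<omega> f \<le> B" by (simp add: bergman_norm_def)
qed

text \<open>The condition \<open>k p \<ge> 4\<close> makes the \<open>p\<close>-th power of the kernel integrable over the plane, with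
  integral of order \<open>R^2\<close>; the factor \<open>R^(- 2/p)\<close> normalizes this away.\<close>
lemma in_bergman_of_concentrated:
  assumes p: "p > 0" and k: "4 \<le> k * p" and R: "R > 0" and f: "f holomorphic_on unit_disk"
    and bd: "\<And>z. z \<in> unit_disk \<Longrightarrow>
      norm (f z) * exp (- \<phi> z) \<le> B * R powr (- 2 / p) * (R / (R + norm (z - a))) ^ k"
    and B: "B > 0"
  shows "f \<in> bergman p \<omega>" "bergman_norm p \<omega> f \<le> (64 / 3 * pi * B powr p) powr (1 / p)"
proof -
  let ?g = "\<lambda>z. norm (f z) powr p * \<omega> z powr (p / 2)"
  have le: "?g z \<le> B powr p * R powr (- 2) * (R / (R + norm (z - a))) ^ 4" if z: "z \<in> unit_disk" for z
  proof -
    define x where "x = R / (R + norm (z - a))"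
    have x: "0 < x" "x \<le> 1"
      using R by (auto simp: x_def add_pos_nonneg)
    have "?g z \<le> (B * R powr (- 2 / p) * x ^ k) powr p"
      unfolding weighted_power_eq[OF z] using bd[OF z] p by (intro powr_mono2) (auto simp: x_def)
    also have "\<dots> = B powr p * R powr (- 2) * x powr (k * p)"
      using x p by (simp add: powr_mult powr_powr powr_realpow[symmetric])
    also have "\<dots> \<le> B powr p * R powr (- 2) * x powr 4"
      using x k by (intro mult_left_mono powr_mono') auto
    also have "x powr 4 = x ^ 4" using x by simp
    finally show ?thesis by (simp add: x_def)
  qed
  have nz: "R + norm (z - a) \<noteq> 0" for z
    using R norm_ge_zero[of "z - a"] by linarith
  have "(\<integral>\<^sup>+z. ennreal (?g z) \<partial>area)
      \<le> (\<integral>\<^sup>+z. ennreal (B powr p * R powr (- 2)) * ennreal ((R / (R + norm (z - a))) ^ 4) \<partial>area)"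
    using le R by (intro nn_integral_mono) (simp add: ennreal_mult[symmetric] ennreal_leI)
  also have "\<dots> = ennreal (B powr p * R powr (- 2)) * (\<integral>\<^sup>+z. ennreal ((R / (R + norm (z - a))) ^ 4) \<partial>area)"
    by (rule nn_integral_cmult) (auto intro!: borel_measurable_area_continuous continuous_intros simp: nz)
  also have "\<dots> \<le> ennreal (B powr p * R powr (- 2)) * ennreal (64 / 3 * pi * R\<^sup>2)"
    by (intro mult_left_mono nn_integral_quartic_kernel R) auto
  also have "\<dots> = ennreal (64 / 3 * pi * B powr p)"
    using R by (simp add: ennreal_mult[symmetric] powr_minus_divide)
  finally have nn: "(\<integral>\<^sup>+z. ennreal (?g z) \<partial>area) \<le> ennreal (64 / 3 * pi * B powr p)" .
  have int: "integrable area ?g"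
    using nn by (intro integrableI_nonneg weighted_power_measurable f)
       (auto intro: le_less_trans[OF _ ennreal_less_top])
  then show "f \<in> bergman p \<omega>" using f by (simp add: bergman_def)
  have "integral\<^sup>L area ?g \<le> 64 / 3 * pi * B powr p"
    using nn nn_integral_eq_integral[OF int] by simp
  then show "bergman_norm p \<omega> f \<le> (64 / 3 * pi * B powr p) powr (1 / p)"
    unfolding bergman_norm_def using p by (intro powr_mono2 integral_nonneg_AE) auto
qed

text \<open>The degree is \<open>\<lceil>flux\<rceil> + 1\<close> rather than \<open>\<lceil>flux\<rceil>\<close> so that the logarithmic derivative at \<open>a\<close> dominates
  \<open>1 + \<phi>'(a)\<close> and not just \<open>\<phi>'(a)\<close>. One function serves for the value and for the derivative.\<close>
lemma peak_in_bergman: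
  assumes p: "p > 0"
  obtains M where "\<And>a. 1/2 \<le> norm a \<Longrightarrow> norm a < 1 \<Longrightarrow>
    \<exists>f\<in>bergman p \<omega>. bergman_norm p \<omega> f \<le> M \<and>
      exp (\<phi> a) * \<tau> a powr (- 2 / p) \<le> norm (f a) \<and>
      exp (\<phi> a) * \<tau> a powr (- 2 / p) * (1 + radial_deriv \<phi> a) \<le> norm (deriv f a)"
proof -
  define k where "k = nat \<lceil>4 / p\<rceil>"
  have "4 / p \<le> k" using p by (simp add: k_def)
  then have k: "4 \<le> k * p" using p by (simp add: divide_le_eq)
  obtain K where K: "0 < K" and bound: "\<And>a z. 1/2 \<le> norm a \<Longrightarrow> norm a < 1 \<Longrightarrow> norm z < 1 \<Longrightarrow>
       norm (peak (Suc (nat \<lceil>flux (norm a)\<rceil>)) (nat \<lceil>1 / \<tau> a\<rceil>) k (z / a)) * exp (\<phi> a - \<phi> z)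
         \<le> K * (\<tau> a / (\<tau> a + norm (z - a))) ^ k"
    using weighted_peak_bound[of k] by blast
  show ?thesis
  proof (rule that[of "(64 / 3 * pi * K powr p) powr (1 / p)"])
    fix a :: complex assume a: "1/2 \<le> norm a" "norm a < 1"
    have a0: "a \<noteq> 0" "a \<in> unit_disk" using a by auto
    have t: "\<tau> a > 0" using tau_pos a by auto
    define N m e where "N = Suc (nat \<lceil>flux (norm a)\<rceil>)" and "m = nat \<lceil>1 / \<tau> a\<rceil>"
      and "e = exp (\<phi> a) * \<tau> a powr (- 2 / p)"
    define f where "f = (\<lambda>z. of_real e * peak N m k (z / a))"
    have e: "e > 0" using t by (simp add: e_def)
    have m: "m > 0" using t by (simp add: m_def)
    have hol: "f holomorphic_on unit_disk"
      unfolding f_def using a0 by (intro holomorphic_intros peak_holomorphic) auto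
    have fb: "norm (f z) * exp (- \<phi> z) \<le> K * \<tau> a powr (- 2 / p) * (\<tau> a / (\<tau> a + norm (z - a))) ^ k"
      if "z \<in> unit_disk" for z
    proof -
      have "norm (f z) * exp (- \<phi> z) = \<tau> a powr (- 2 / p) * (norm (peak N m k (z / a)) * exp (\<phi> a - \<phi> z))"
        by (simp add: f_def norm_mult e_def abs_mult exp_diff exp_minus divide_inverse)
      also have "\<dots> \<le> \<tau> a powr (- 2 / p) * (K * (\<tau> a / (\<tau> a + norm (z - a))) ^ k)"
        unfolding N_def m_def using bound[of a z] a that by (intro mult_left_mono) auto
      finally show ?thesis by (simp add: mult_ac)
    qed
    note mem = in_bergman_of_concentrated[OF p k t hol fb K]
    have fa: "norm (f a) = e" using a0 m e by (simp add: f_def peak_at_1)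
    \<comment> \<open>the derivative at \<open>1\<close> of \<open>peak N m k\<close>; the averages only increase it\<close>
    define N' where "N' = N + k * ((\<Sum>j<m. real j) / m)"
    have "N' \<ge> N" unfolding N'_def by (simp add: sum_nonneg)
    moreover have "flux (norm a) + 1 \<le> N" unfolding N_def by linarith
    ultimately have "flux (norm a) + 1 \<le> N'" by linarith
    moreover have "norm a * (1 + radial_deriv \<phi> a) \<le> flux (norm a) + 1"
      using a radial_deriv_eq[OF a0(2)] by (simp add: distrib_left)
    ultimately have N': "norm a * (1 + radial_deriv \<phi> a) \<le> N'" by linarith
    have "(peak N m k has_field_derivative of_real N') (at (a / a))"
      using DERIV_peak_at_1[OF m] a0 by (simp add: N'_def)
    from DERIV_cmult[OF DERIV_chain2[OF this DERIV_cdivide[OF DERIV_ident]]]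
    have d: "(f has_field_derivative of_real e * (of_real N' * (1 / a))) (at a)"
      unfolding f_def .
    have rd: "radial_deriv \<phi> a \<ge> 0" using radial_deriv_nonneg a0 by auto
    have "N' \<ge> 0" using N' rd by (smt (verit) mult_nonneg_nonneg norm_ge_zero)
    then have "norm (deriv f a) = e * (N' / norm a)"
      using DERIV_imp_deriv[OF d] e by (simp add: norm_mult norm_divide)
    moreover have "1 + radial_deriv \<phi> a \<le> N' / norm a"
      using N' a0 by (simp add: pos_le_divide_eq mult.commute)
    ultimately have "e * (1 + radial_deriv \<phi> a) \<le> norm (deriv f a)"
      using e by (simp only: mult_left_mono less_imp_le)
    then show "\<exists>f\<in>bergman p \<omega>. bergman_norm p \<omega> f \<le> (64 / 3 * pi * K powr p) powr (1 / p) \<and>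
      exp (\<phi> a) * \<tau> a powr (- 2 / p) \<le> norm (f a) \<and>
      exp (\<phi> a) * \<tau> a powr (- 2 / p) * (1 + radial_deriv \<phi> a) \<le> norm (deriv f a)"
      using mem fa unfolding e_def by (intro bexI[of _ f] conjI) auto
  qed
qed

text \<open>For \<open>\<bar>a\<bar> < 1/2\<close> all quantities are bounded, so multiples of \<open>1\<close> and of \<open>z\<close> are good enough.\<close>
lemma test_functions:
  assumes p: "p > 0"
  obtains M where
    "\<And>a. a \<in> unit_disk \<Longrightarrow> \<exists>f\<in>bergman p \<omega>. bergman_norm p \<omega> f \<le> M \<and>
       exp (\<phi> a) * \<tau> a powr (- 2 / p) \<le> norm (f a)"
    "\<And>a. a \<in> unit_disk \<Longrightarrow> \<exists>f\<in>bergman p \<omega>. bergman_norm p \<omega> f \<le> M \<and>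
       exp (\<phi> a) * \<tau> a powr (- 2 / p) * (1 + radial_deriv \<phi> a) \<le> norm (deriv f a)"
proof -
  obtain M where M: "\<And>a. 1/2 \<le> norm a \<Longrightarrow> norm a < 1 \<Longrightarrow>
    \<exists>f\<in>bergman p \<omega>. bergman_norm p \<omega> f \<le> M \<and>
      exp (\<phi> a) * \<tau> a powr (- 2 / p) \<le> norm (f a) \<and>
      exp (\<phi> a) * \<tau> a powr (- 2 / p) * (1 + radial_deriv \<phi> a) \<le> norm (deriv f a)"
    using peak_in_bergman[OF p] by blast
  have "continuous_on {0..1/2} \<Phi>'"
    by (rule DERIV_continuous_on, rule has_field_derivative_at_within,
        rule C1_on_DERIV_real_axis[OF C1_phi(2)]) auto
  then obtain x where "x \<in> {0..1/2}" and x: "\<And>y. y \<in> {0..1/2} \<Longrightarrow> \<Phi>' y \<le> \<Phi>' x"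
    using continuous_attains_sup[of "{0..1/2::real}" \<Phi>'] by auto
  define b where "b = 1 + \<Phi>' x"
  have b: "1 \<le> b" using Phi'_nonneg[of x] \<open>x \<in> _\<close> by (simp add: b_def)
  define e where "e = exp (\<Phi> (1/2)) * T (1/2) powr (- 2 / p) * b"
  have t2: "T (1/2) > 0" using T_pos[of "1/2"] by simp
  then have e: "e > 0" using b by (simp add: e_def)
  have ea: "exp (\<phi> a) * \<tau> a powr (- 2 / p) * (1 + radial_deriv \<phi> a) \<le> e"
    and ea': "exp (\<phi> a) * \<tau> a powr (- 2 / p) \<le> e" if a: "norm a < 1/2" for a
  proof -
    have "\<phi> a \<le> \<Phi> (1/2)" using phi_radial[of a] Phi_mono[of "norm a" "1/2"] a by simp
    moreover have "\<tau> a powr (- 2 / p) \<le> T (1/2) powr (- 2 / p)"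
      using tau_radial[of a] T_antimono[of "norm a" "1/2"] a p t2
      by (intro powr_mono2') auto
    ultimately have 1: "exp (\<phi> a) * \<tau> a powr (- 2 / p) \<le> exp (\<Phi> (1/2)) * T (1/2) powr (- 2 / p)"
      by (intro mult_mono) auto
    have "1 + radial_deriv \<phi> a \<le> b" using x[of "norm a"] radial_deriv_eq[of a] a by (simp add: b_def)
    then show "exp (\<phi> a) * \<tau> a powr (- 2 / p) * (1 + radial_deriv \<phi> a) \<le> e"
      unfolding e_def using radial_deriv_nonneg[of a] a by (intro mult_mono[OF 1]) auto
    have "exp (\<Phi> (1/2)) * T (1/2) powr (- 2 / p) * 1 \<le> e"
      unfolding e_def using b by (intro mult_left_mono) auto
    then show "exp (\<phi> a) * \<tau> a powr (- 2 / p) \<le> e" using 1 by simp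
  qed
  have phi0: "\<Phi> 0 \<le> \<phi> z" if "z \<in> unit_disk" for z
    using phi_radial[OF that] Phi_mono[of 0 "norm z"] that by simp
  have bd: "norm (of_real e * g z) * exp (- \<phi> z) \<le> e * exp (- \<Phi> 0)"
    if "z \<in> unit_disk" "norm (g z) \<le> 1" for g :: "complex \<Rightarrow> complex" and z
  proof -
    have "norm (of_real e * g z) * exp (- \<phi> z) = e * (norm (g z) * exp (- \<phi> z))"
      using e by (simp add: norm_mult)
    also have "\<dots> \<le> e * (1 * exp (- \<Phi> 0))"
      using e phi0 that by (intro mult_left_mono mult_mono) auto
    finally show ?thesis by simp
  qed
  note const = in_bergman_of_bounded[OF p _ bd[where g = "\<lambda>z. 1"]]
  note ident = in_bergman_of_bounded[OF p _ bd[where g = "\<lambda>z. z"]]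
  define M' where "M' = max M (e * exp (- \<Phi> 0))"
  have M': "M \<le> M'" "e * exp (- \<Phi> 0) \<le> M'" by (auto simp: M'_def)
  show ?thesis
  proof (rule that[of M'])
    fix a :: complex assume a: "a \<in> unit_disk"
    show "\<exists>f\<in>bergman p \<omega>. bergman_norm p \<omega> f \<le> M' \<and>
       exp (\<phi> a) * \<tau> a powr (- 2 / p) \<le> norm (f a)"
    proof (cases "1/2 \<le> norm a")
      case True
      then show ?thesis using M[of a] a M' by (auto intro: order_trans)
    next
      case False
      have "(\<lambda>z. of_real e * 1) holomorphic_on unit_disk" by (intro holomorphic_intros)
      then show ?thesis using const M' ea'[of a] False e
        by (intro bexI[of _ "\<lambda>z. of_real e * 1"]) (auto intro: order_trans)
    qed
    show "\<exists>f\<in>bergman p \<omega>. bergman_norm p \<omega> f \<le> M' \<and>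
       exp (\<phi> a) * \<tau> a powr (- 2 / p) * (1 + radial_deriv \<phi> a) \<le> norm (deriv f a)"
    proof (cases "1/2 \<le> norm a")
      case True
      then show ?thesis using M[of a] a M' by (auto intro: order_trans)
    next
      case False
      have hol: "(\<lambda>z. of_real e * z) holomorphic_on unit_disk" by (intro holomorphic_intros)
      have "deriv (\<lambda>z. of_real e * z) a = of_real e * 1"
        by (rule DERIV_imp_deriv) (rule DERIV_cmult, rule DERIV_ident)
      then have "norm (deriv (\<lambda>z. of_real e * z) a) = e" using e by simp
      then show ?thesis using ident[OF hol] M' ea[of a] False
        by (intro bexI[of _ "\<lambda>z. of_real e * z"]) (auto intro: order_trans)
    qed
  qed
qed

section \<open>Weighted bound for the derivative\<close>

text \<open>At distance \<open>\<delta> \<tau>(a)\<close> from \<open>a\<close> the Laplacian is of order \<open>1/\<tau>(a)^2\<close>, so two applications of the mean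
  value theorem bound the excess by a multiple of \<open>(\<delta> \<tau>(a))^2/\<tau>(a)^2 = \<delta>^2\<close>.\<close>
lemma excess_bounded_near:
  assumes \<delta>: "0 < \<delta>" and \<kappa>: "0 < \<kappa>"
    and quarter: "\<And>a. 0 \<le> a \<Longrightarrow> a < 1 \<Longrightarrow> \<delta> * T a \<le> 1 / 4"
    and comparable: "\<And>a r. 0 \<le> a \<Longrightarrow> a < 1 \<Longrightarrow> a \<le> r \<Longrightarrow> r \<le> a + \<delta> * T a \<Longrightarrow> \<kappa> * T a \<le> T r"
  obtains B where "0 \<le> B"
    "\<And>a r. 1/2 \<le> a \<Longrightarrow> a < 1 \<Longrightarrow> r < 1 \<Longrightarrow> \<bar>r - a\<bar> \<le> \<delta> * T a \<Longrightarrow> excess a r \<le> B"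
proof -
  obtain k K where k: "0 < k" and K: "0 < K"
    and lap: "\<And>r. 0 \<le> r \<Longrightarrow> r < 1 \<Longrightarrow> k / (T r)\<^sup>2 \<le> laplacian \<phi> (of_real r)"
      "\<And>r. 0 \<le> r \<Longrightarrow> r < 1 \<Longrightarrow> laplacian \<phi> (of_real r) \<le> K / (T r)\<^sup>2"
    using laplacian_bounds by blast
  have "excess a r \<le> 4 * \<delta>\<^sup>2 * (K / \<kappa>\<^sup>2)"
    if a: "1/2 \<le> a" "a < 1" and r: "r < 1" "\<bar>r - a\<bar> \<le> \<delta> * T a" for a r
  proof -
    have t: "T a > 0" using T_pos[of a] a by simp
    have \<kappa>1: "\<kappa> * T a \<le> T a" using comparable[of a a] a \<delta> t by simp
    define Q where "Q = K / (\<kappa> * T a)\<^sup>2"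
    have Q: "Q \<ge> 0" using K by (simp add: Q_def)
    let ?S = "closed_segment a r"
    have S: "1/4 \<le> x \<and> x < 1 \<and> \<bar>x - a\<bar> \<le> \<delta> * T a" if "x \<in> ?S" for x
      using that a r quarter[of a] by (auto simp: closed_segment_eq_real_ivl split: if_splits)
    have d_flux: "\<bar>flux x - flux a\<bar> \<le> Q * \<bar>x - a\<bar>" if x: "x \<in> ?S" for x
    proof -
      have "norm (flux x - flux a) \<le> Q * norm (x - a)"
      proof (rule field_differentiable_bound[of ?S flux "\<lambda>x. x * laplacian \<phi> (of_real x)"])
        fix y assume y: "y \<in> ?S"
        show "(flux has_field_derivative y * laplacian \<phi> (of_real y)) (at y within ?S)"
          using S[OF y] by (auto intro: has_field_derivative_at_within[OF DERIV_flux])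
        have ty: "\<kappa> * T a \<le> T y"
        proof (cases "a \<le> y")
          case True
          then show ?thesis using comparable[of a y] S[OF y] a by auto
        next
          case False
          then have "T a \<le> T y" using T_antimono[of y a] S[OF y] a by auto
          then show ?thesis using \<kappa>1 by simp
        qed
        have ty0: "T y > 0" using S[OF y] by (intro T_pos) auto
        have "laplacian \<phi> (of_real y) \<le> K / (T y)\<^sup>2" using lap(2)[of y] S[OF y] by auto
        also have "\<dots> \<le> Q"
          unfolding Q_def using ty ty0 \<kappa> t K by (intro divide_left_mono power_mono mult_pos_pos zero_less_power) auto
        finally have "y * laplacian \<phi> (of_real y) \<le> 1 * Q"
          using S[OF y] laplacian_pos[of "of_real y"] by (intro mult_mono) auto
        then show "norm (y * laplacian \<phi> (of_real y)) \<le> Q"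
          using S[OF y] laplacian_pos[of "of_real y"] by (simp add: abs_mult)
      qed (use x in auto)
      then show ?thesis by simp
    qed
    have "norm (excess a r - excess a a) \<le> 4 * (Q * (\<delta> * T a)) * norm (r - a)"
    proof (rule field_differentiable_bound[of ?S "excess a" "\<lambda>x. (flux x - flux a) / x"])
      fix y assume y: "y \<in> ?S"
      show "(excess a has_field_derivative (flux y - flux a) / y) (at y within ?S)"
        using S[OF y] a by (auto intro: has_field_derivative_at_within[OF DERIV_excess])
      have "\<bar>flux y - flux a\<bar> \<le> Q * (\<delta> * T a)"
        using d_flux[OF y] S[OF y] Q by (meson mult_left_mono order_trans)
      moreover have "1 / y \<le> 4" using S[OF y] by (simp add: divide_le_eq)
      ultimately have "\<bar>flux y - flux a\<bar> * (1 / y) \<le> Q * (\<delta> * T a) * 4"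
        using S[OF y] by (intro mult_mono) auto
      then show "norm ((flux y - flux a) / y) \<le> 4 * (Q * (\<delta> * T a))"
        using S[OF y] by (simp add: abs_mult mult_ac)
    qed auto
    also have "\<dots> \<le> 4 * (Q * (\<delta> * T a)) * (\<delta> * T a)"
      using r Q \<delta> t by (intro mult_left_mono) auto
    also have "\<dots> = 4 * \<delta>\<^sup>2 * (K / \<kappa>\<^sup>2)"
      using t by (simp add: Q_def power2_eq_square)
    finally show ?thesis using a by simp
  qed
  moreover have "0 \<le> 4 * \<delta>\<^sup>2 * (K / \<kappa>\<^sup>2)" using K by simp
  ultimately show ?thesis using that by blast
qed

text \<open>For \<open>\<bar>z\<bar> \<ge> 1/2\<close> take \<open>H(\<zeta>) = \<phi>(z) + flux \<bar>z\<bar> \<cdot> Ln (\<zeta>/z)\<close>: then \<open>\<phi> - Re H\<close> is the excess and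
  \<open>\<bar>H'(z)\<bar> = flux \<bar>z\<bar> / \<bar>z\<bar> = \<phi>'(z)\<close>. The logarithm is singular at the origin, so for \<open>\<bar>z\<bar> < 1/2\<close> a
  constant is used; the disks then stay in \<open>\<bar>\<zeta>\<bar> \<le> 3/4\<close>, where \<open>\<phi>\<close> is bounded.
  The radius \<open>2 \<delta> \<tau>(z)\<close> leaves room for holomorphy on a closed disk of radius \<open>\<delta> \<tau>(z)\<close>.\<close>
lemma local_holomorphic_majorant:
  obtains \<delta> B where "0 < \<delta>" "0 \<le> B"
    "\<And>z. z \<in> unit_disk \<Longrightarrow> 2 * (\<delta> * \<tau> z) \<le> (1 - norm z) / 2"
    "\<And>z. z \<in> unit_disk \<Longrightarrow> \<exists>H. H holomorphic_on ball z (2 * (\<delta> * \<tau> z)) \<and> H z = of_real (\<phi> z) \<and>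
        norm (deriv H z) \<le> radial_deriv \<phi> z \<and>
        (\<forall>\<zeta>\<in>ball z (2 * (\<delta> * \<tau> z)). \<phi> \<zeta> \<le> Re (H \<zeta>) + B)"
proof -
  obtain d \<kappa> where d: "0 < d" and \<kappa>: "0 < \<kappa>"
    and half: "\<And>a. 0 \<le> a \<Longrightarrow> a < 1 \<Longrightarrow> d * T a \<le> (1 - a) / 2"
    and quarter: "\<And>a. 0 \<le> a \<Longrightarrow> a < 1 \<Longrightarrow> d * T a \<le> 1 / 4"
    and comparable: "\<And>a r. 0 \<le> a \<Longrightarrow> a < 1 \<Longrightarrow> a \<le> r \<Longrightarrow> r \<le> a + d * T a \<Longrightarrow> \<kappa> * T a \<le> T r"
    using tau_disk_radius by blast
  obtain B0 where B0: "0 \<le> B0"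
    "\<And>a r. 1/2 \<le> a \<Longrightarrow> a < 1 \<Longrightarrow> r < 1 \<Longrightarrow> \<bar>r - a\<bar> \<le> d * T a \<Longrightarrow> excess a r \<le> B0"
    using excess_bounded_near[OF d \<kappa> quarter comparable] by blast
  define B where "B = max B0 (\<Phi> (3/4) - \<Phi> 0)"
  have B: "B0 \<le> B" "\<Phi> (3/4) - \<Phi> 0 \<le> B" by (auto simp: B_def)
  show ?thesis
  proof (rule that[of "d / 2" B])
    show "0 < d / 2" "0 \<le> B" using d B0 B by auto
    fix z :: complex assume z: "z \<in> unit_disk"
    define a where "a = norm z"
    have a: "0 \<le> a" "a < 1" using z by (auto simp: a_def)
    have rad: "2 * (d / 2 * \<tau> z) = d * T a" using tau_radial[OF z] by (simp add: a_def)
    show "2 * (d / 2 * \<tau> z) \<le> (1 - norm z) / 2" unfolding rad using half[OF a] by (simp add: a_def)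
    have near: "\<bar>norm \<zeta> - a\<bar> \<le> d * T a" "norm \<zeta> < 1" if "\<zeta> \<in> ball z (d * T a)" for \<zeta>
    proof -
      have "norm (\<zeta> - z) < d * T a" using that by (simp add: dist_norm norm_minus_commute)
      then show "\<bar>norm \<zeta> - a\<bar> \<le> d * T a"
        using norm_triangle_ineq3[of \<zeta> z] by (simp add: a_def)
      then have "norm \<zeta> \<le> a + (1 - a) / 2"
        using half[OF a] abs_ge_self[of "norm \<zeta> - a"] by linarith
      also have "\<dots> < 1" using a by (simp add: field_simps)
      finally show "norm \<zeta> < 1" .
    qed
    show "\<exists>H. H holomorphic_on ball z (2 * (d / 2 * \<tau> z)) \<and> H z = of_real (\<phi> z) \<and>
        norm (deriv H z) \<le> radial_deriv \<phi> z \<and>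
        (\<forall>\<zeta>\<in>ball z (2 * (d / 2 * \<tau> z)). \<phi> \<zeta> \<le> Re (H \<zeta>) + B)"
      unfolding rad
    proof (cases "1/2 \<le> a")
      case True
      have z0: "z \<noteq> 0" using True by (auto simp: a_def)
      define H where "H = (\<lambda>\<zeta>. of_real (\<phi> z) + of_real (flux a) * Ln (\<zeta> / z))"
      have right: "Re (\<zeta> / z) > 0" if "\<zeta> \<in> ball z (d * T a)" for \<zeta>
      proof -
        have "norm (\<zeta> - z) < d * T a" using that by (simp add: dist_norm norm_minus_commute)
        then have "norm (\<zeta> - z) < a" using quarter[OF a] True by simp
        then have "norm ((\<zeta> - z) / z) < 1" using z0 by (simp add: norm_divide a_def)
        then have "norm (1 - \<zeta> / z) < 1" using z0 by (simp add: diff_divide_distrib norm_minus_commute)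
        then show ?thesis using complex_Re_le_cmod[of "1 - \<zeta> / z"] by simp
      qed
      have slit: "\<zeta> / z \<notin> \<real>\<^sub>\<le>\<^sub>0" if "\<zeta> \<in> ball z (d * T a)" for \<zeta>
        using right[OF that] unfolding complex_nonpos_Reals_iff by linarith
      have hol: "H holomorphic_on ball z (d * T a)"
        unfolding H_def using slit z0 by (intro holomorphic_intros) auto
      have "((\<lambda>\<zeta>. \<zeta> / z) has_field_derivative 1 / z) (at z)"
        by (rule DERIV_cdivide) (rule DERIV_ident)
      from DERIV_chain2[OF has_field_derivative_Ln this]
      have "((\<lambda>\<zeta>. Ln (\<zeta> / z)) has_field_derivative 1 / z) (at z)"
        using z0 by simp
      from DERIV_add[OF DERIV_const DERIV_cmult[OF this]]
      have "(H has_field_derivative of_real (flux a) * (1 / z)) (at z)"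
        unfolding H_def by simp
      then have "deriv H z = of_real (flux a) * (1 / z)" by (rule DERIV_imp_deriv)
      then have dH: "norm (deriv H z) = radial_deriv \<phi> z"
        using Phi'_nonneg[OF a] z0 True radial_deriv_eq[OF z]
        by (simp add: norm_mult norm_divide a_def[symmetric] abs_mult)
      have "\<phi> \<zeta> \<le> Re (H \<zeta>) + B" if \<zeta>: "\<zeta> \<in> ball z (d * T a)" for \<zeta>
      proof -
        have nz: "\<zeta> / z \<noteq> 0" using right[OF \<zeta>] by auto
        have "Re (H \<zeta>) = \<phi> z + flux a * ln (norm \<zeta> / a)"
          using nz by (simp add: H_def norm_divide a_def)
        moreover have "\<phi> \<zeta> = \<Phi> (norm \<zeta>)" "\<phi> z = \<Phi> a"
          using phi_radial[of \<zeta>] phi_radial[OF z] near(2)[OF \<zeta>] by (auto simp: a_def)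
        ultimately have "\<phi> \<zeta> - Re (H \<zeta>) = excess a (norm \<zeta>)" by (simp add: excess_def)
        also have "\<dots> \<le> B" using B0(2)[OF True a(2) near(2)[OF \<zeta>] near(1)[OF \<zeta>]] B by simp
        finally show ?thesis by simp
      qed
      with hol dH z0 show "\<exists>H. H holomorphic_on ball z (d * T a) \<and> H z = of_real (\<phi> z) \<and>
          norm (deriv H z) \<le> radial_deriv \<phi> z \<and> (\<forall>\<zeta>\<in>ball z (d * T a). \<phi> \<zeta> \<le> Re (H \<zeta>) + B)"
        by (intro exI[of _ H]) (auto simp: H_def)
    next
      case False
      have "\<phi> \<zeta> \<le> \<phi> z + B" if \<zeta>: "\<zeta> \<in> ball z (d * T a)" for \<zeta>
      proof -
        have "norm \<zeta> \<le> 3/4" using near(1)[OF \<zeta>] quarter[OF a] False by linarith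
        then have "\<phi> \<zeta> \<le> \<Phi> (3/4)"
          using phi_radial[of \<zeta>] Phi_mono[of "norm \<zeta>" "3/4"] by simp
        moreover have "\<Phi> 0 \<le> \<phi> z"
          using phi_radial[OF z] Phi_mono[of 0 a] a by (simp add: a_def)
        ultimately show ?thesis using B by simp
      qed
      then show "\<exists>H. H holomorphic_on ball z (d * T a) \<and> H z = of_real (\<phi> z) \<and>
          norm (deriv H z) \<le> radial_deriv \<phi> z \<and> (\<forall>\<zeta>\<in>ball z (d * T a). \<phi> \<zeta> \<le> Re (H \<zeta>) + B)"
        using radial_deriv_nonneg[OF z] by (intro exI[of _ "\<lambda>_. of_real (\<phi> z)"]) auto
    qed
  qed
qed

text \<open>Apply \<open>large_on_ball_of_maximal_point\<close> with \<open>\<beta> = 2/q\<close> to \<open>u = h exp (- H)\<close>, whose modulus is at most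
  \<open>exp B \<bar>h\<bar> exp (- \<phi>)\<close>, and estimate \<open>h' exp (- H) = u' + H' u\<close> at \<open>z\<close>. The Cauchy bound for \<open>u'\<close> costs
  a factor \<open>1/\<tau>(z)\<close> and the second term a factor \<open>\<phi>'(z)\<close>; both are absorbed by \<open>1 + \<phi>'(z)\<close>.\<close>
lemma derivative_bounded_by_local_norm:
  assumes q: "q > 0"
  obtains \<delta> C where "0 < \<delta>" "0 < C"
    "\<And>z. z \<in> unit_disk \<Longrightarrow> \<delta> * \<tau> z \<le> (1 - norm z) / 2"
    "\<And>h z. h \<in> bergman q \<omega> \<Longrightarrow> z \<in> unit_disk \<Longrightarrow>
      norm (deriv h z) * exp (- \<phi> z) * \<tau> z powr (2 / q) / (1 + radial_deriv \<phi> z) \<le>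
        C * (\<integral>\<zeta>. indicator (ball z (\<delta> * \<tau> z)) \<zeta> * (norm (h \<zeta>) powr q * \<omega> \<zeta> powr (q / 2)) \<partial>area) powr (1 / q)"
proof -
  obtain \<delta> B where \<delta>: "0 < \<delta>" and B: "0 \<le> B"
    and inside: "\<And>z. z \<in> unit_disk \<Longrightarrow> 2 * (\<delta> * \<tau> z) \<le> (1 - norm z) / 2"
    and major: "\<And>z. z \<in> unit_disk \<Longrightarrow> \<exists>H. H holomorphic_on ball z (2 * (\<delta> * \<tau> z)) \<and> H z = of_real (\<phi> z) \<and>
        norm (deriv H z) \<le> radial_deriv \<phi> z \<and>
        (\<forall>\<zeta>\<in>ball z (2 * (\<delta> * \<tau> z)). \<phi> \<zeta> \<le> Re (H \<zeta>) + B)"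
    using local_holomorphic_majorant by blast
  obtain C1 where C1: "0 < C1" "\<And>a. 0 \<le> a \<Longrightarrow> a < 1 \<Longrightarrow> 1 / T a \<le> C1 * (1 + \<Phi>' a)"
    using inverse_tau_le_deriv by blast
  define \<beta> \<eta> where "\<beta> = 2 / q" and "\<eta> = 1 / (8 * 2 powr \<beta>)"
  have \<beta>: "\<beta> > 0" and \<eta>: "\<eta> > 0" using q by (auto simp: \<beta>_def \<eta>_def)
  define C where "C = 2 * exp B * \<eta> powr (- \<beta>) * ((\<delta> / 2) powr (- \<beta>) * (2 / \<delta> * C1 + 1))"
  have C: "C > 0" using \<delta> C1 \<eta> by (simp add: C_def add_pos_pos)
  show ?thesis
  proof (rule that[of \<delta> C])
    show "0 < \<delta>" "0 < C" by fact+
    fix z :: complex assume z: "z \<in> unit_disk"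
    have t: "\<tau> z > 0" using tau_pos[OF z] .
    define R where "R = \<delta> * \<tau> z"
    have R: "R > 0" using t \<delta> by (simp add: R_def)
    have R2: "2 * R \<le> (1 - norm z) / 2" using inside[OF z] by (simp add: R_def)
    then show "\<delta> * \<tau> z \<le> (1 - norm z) / 2" using R by (simp add: R_def)
    have disk: "ball z (2 * R) \<subseteq> unit_disk"
    proof
      fix \<zeta> assume "\<zeta> \<in> ball z (2 * R)"
      then have "norm (\<zeta> - z) < 2 * R" by (simp add: dist_norm norm_minus_commute)
      then have "norm \<zeta> < norm z + (1 - norm z) / 2" using norm_triangle_sub[of \<zeta> z] R2 by linarith
      then show "\<zeta> \<in> unit_disk" using z by (simp add: field_simps)
    qed
    fix h assume h: "h \<in> bergman q \<omega>"
    then have holh: "h holomorphic_on unit_disk"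
      and int: "integrable area (\<lambda>\<zeta>. norm (h \<zeta>) powr q * \<omega> \<zeta> powr (q / 2))" (is "integrable area ?g")
      by (auto simp: bergman_def)
    define I where "I = (\<integral>\<zeta>. indicator (ball z R) \<zeta> * ?g \<zeta> \<partial>area)"
    obtain H where holH: "H holomorphic_on ball z (2 * R)" and Hz: "H z = of_real (\<phi> z)"
      and dH: "norm (deriv H z) \<le> radial_deriv \<phi> z"
      and up: "\<And>\<zeta>. \<zeta> \<in> ball z (2 * R) \<Longrightarrow> \<phi> \<zeta> \<le> Re (H \<zeta>) + B"
      using major[OF z] unfolding R_def by blast
    define u where "u = (\<lambda>\<zeta>. h \<zeta> * exp (- H \<zeta>))"
    have holu: "u holomorphic_on ball z (2 * R)"
      unfolding u_def using holH holomorphic_on_subset[OF holh disk] by (intro holomorphic_intros)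
    have sub: "cball z R \<subseteq> ball z (2 * R)" using R by auto
    obtain z0 d where d: "d > 0" and small: "ball z0 (\<eta> * d) \<subseteq> ball z R"
      and low: "\<And>\<zeta>. \<zeta> \<in> ball z0 (\<eta> * d) \<Longrightarrow> norm (u z0) / 2 \<le> norm (u \<zeta>)"
      and max: "\<And>\<zeta>. \<zeta> \<in> cball z R \<Longrightarrow> norm (u \<zeta>) * (R - norm (\<zeta> - z)) powr \<beta> \<le> norm (u z0) * d powr \<beta>"
    proof -
      have eq: "d / (8 * 2 powr \<beta>) = \<eta> * d" for d by (simp add: \<eta>_def)
      show ?thesis
        using large_on_ball_of_maximal_point[OF holu open_ball sub R \<beta>] that unfolding eq by blast
    qed
    define J where "J = norm (u z0) * d powr \<beta>"
    have "J \<le> 2 * exp B * \<eta> powr (- \<beta>) * I powr (1 / q)"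
    proof -
      define s where "s = norm (u z0) / 2 * exp (- B)"
      have s: "s \<ge> 0" by (simp add: s_def)
      have ball0: "ball z0 (\<eta> * d) \<subseteq> unit_disk" using small sub disk by fastforce
      have pw: "indicator (ball z0 (\<eta> * d)) \<zeta> * s powr q \<le> indicator (ball z R) \<zeta> * ?g \<zeta>" for \<zeta>
      proof (cases "\<zeta> \<in> ball z0 (\<eta> * d)")
        case True
        then have \<zeta>: "\<zeta> \<in> ball z R" "\<zeta> \<in> ball z (2 * R)" using small sub by fastforce+
        then have \<zeta>1: "\<zeta> \<in> unit_disk" using disk by blast
        have "s \<le> norm (u \<zeta>) * exp (- B)" unfolding s_def using low[OF True] by (intro mult_right_mono) auto
        also have "\<dots> = norm (h \<zeta>) * exp (- Re (H \<zeta>) - B)"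
          by (simp add: u_def norm_mult exp_diff exp_minus divide_inverse norm_inverse)
        also have "\<dots> \<le> norm (h \<zeta>) * exp (- \<phi> \<zeta>)"
          using up[OF \<zeta>(2)] by (intro mult_left_mono) auto
        finally have "s powr q \<le> (norm (h \<zeta>) * exp (- \<phi> \<zeta>)) powr q"
          using s q by (intro powr_mono2) auto
        then show ?thesis using True \<zeta> by (simp add: weighted_power_eq[OF \<zeta>1])
      qed auto
      have "ball z R \<subseteq> unit_disk"
        using ball_subset_cball[of z R] sub disk by (meson order_trans)
      then have meas: "ball z0 (\<eta> * d) \<in> sets area" "ball z R \<in> sets area"
        using ball0 by (auto intro: sets_area_ball)
      have fin: "emeasure area (ball z0 (\<eta> * d)) = ennreal ((\<eta> * d)\<^sup>2)"
        using ball0 \<eta> d by (intro emeasure_area_ball) auto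
      have "(\<eta> * d)\<^sup>2 * s powr q = (\<integral>\<zeta>. indicator (ball z0 (\<eta> * d)) \<zeta> * s powr q \<partial>area)"
      proof -
        have "measure area (ball z0 (\<eta> * d)) = (\<eta> * d)\<^sup>2" unfolding measure_def fin by simp
        then show ?thesis
          by (simp only: integral_mult_left_zero Bochner_Integration.integral_indicator space_area Int_absorb2[OF ball0])
      qed
      also have "\<dots> \<le> I"
        unfolding I_def
      proof (rule integral_mono)
        show "integrable area (\<lambda>\<zeta>. indicator (ball z0 (\<eta> * d)) \<zeta> * s powr q)"
          using fin meas by (intro integrable_mult_left integrable_real_indicator) auto
        show "integrable area (\<lambda>\<zeta>. indicator (ball z R) \<zeta> * ?g \<zeta>)"
          using integrable_mult_indicator[OF meas(2) int] by simp
      qed (rule pw)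
      finally have "((\<eta> * d)\<^sup>2 * s powr q) powr (1 / q) \<le> I powr (1 / q)"
        using q by (intro powr_mono2) auto
      moreover have "((\<eta> * d)\<^sup>2 * s powr q) powr (1 / q) = (\<eta> powr \<beta> * d powr \<beta>) * s"
      proof -
        have "(\<eta> * d)\<^sup>2 = (\<eta> * d) powr 2" using \<eta> d by simp
        then show ?thesis using \<eta> d s q by (simp only: powr_mult powr_powr) (simp add: \<beta>_def)
      qed
      ultimately have le: "(\<eta> powr \<beta> * d powr \<beta>) * s \<le> I powr (1 / q)" by simp
      have "J = 2 * exp B * \<eta> powr (- \<beta>) * ((\<eta> powr \<beta> * d powr \<beta>) * s)"
      proof -
        have "\<eta> powr (- \<beta>) * \<eta> powr \<beta> = 1" using \<eta> by (simp add: powr_add[symmetric])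
        moreover have "exp B * exp (- B) = 1" by (simp add: exp_add[symmetric])
        moreover have "2 * exp B * \<eta> powr (- \<beta>) * ((\<eta> powr \<beta> * d powr \<beta>) * s)
            = J * (exp B * exp (- B)) * (\<eta> powr (- \<beta>) * \<eta> powr \<beta>)"
          unfolding J_def s_def by algebra
        ultimately show ?thesis by simp
      qed
      also have "\<dots> \<le> 2 * exp B * \<eta> powr (- \<beta>) * I powr (1 / q)"
        by (rule mult_left_mono[OF le]) simp
      finally show ?thesis .
    qed
    moreover have "norm (deriv h z) * exp (- \<phi> z) * \<tau> z powr \<beta> / (1 + radial_deriv \<phi> z)
        \<le> J * ((\<delta> / 2) powr (- \<beta>) * (2 / \<delta> * C1 + 1))"
    proof -
      define D where "D = 1 + radial_deriv \<phi> z"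
      have D: "1 \<le> D" using radial_deriv_nonneg[OF z] by (simp add: D_def)
      have J0: "J \<ge> 0" by (simp add: J_def)
      define U where "U = J * (R / 2) powr (- \<beta>)"
      have U: "norm (u \<zeta>) \<le> U" if \<zeta>: "norm (\<zeta> - z) \<le> R / 2" for \<zeta>
      proof -
        have "norm (u \<zeta>) * (R / 2) powr \<beta> \<le> norm (u \<zeta>) * (R - norm (\<zeta> - z)) powr \<beta>"
          using \<zeta> R \<beta> by (intro mult_left_mono powr_mono2) auto
        also have "\<dots> \<le> J" unfolding J_def using \<zeta> R by (intro max) (auto simp: dist_norm norm_minus_commute)
        finally show ?thesis using R by (simp add: U_def powr_minus field_simps)
      qed
      have "norm ((deriv ^^ 1) u z) \<le> fact 1 * U / (R / 2) ^ 1"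
      proof (rule Cauchy_inequality)
        show "u holomorphic_on ball z (R/2)"
          by (rule holomorphic_on_subset[OF holu]) (use R in auto)
        show "continuous_on (cball z (R/2)) u"
          by (rule holomorphic_on_imp_continuous_on, rule holomorphic_on_subset[OF holu]) (use R in auto)
      qed (use U R in \<open>auto simp: norm_minus_commute\<close>)
      then have du: "norm (deriv u z) \<le> U * (2 / R)" by simp
      have zin: "z \<in> ball z (2 * R)" using R by simp
      have "(h has_field_derivative deriv h z) (at z)"
        using holomorphic_derivI[OF holh _ z] by simp
      moreover have dHz: "(H has_field_derivative deriv H z) (at z)"
        using holomorphic_derivI[OF holH _ zin] by simp
      ultimately have "(u has_field_derivative (deriv h z - deriv H z * h z) * exp (- H z)) (at z)"
        unfolding u_def by (auto intro!: derivative_eq_intros simp: algebra_simps)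
      then have "deriv u z = (deriv h z - deriv H z * h z) * exp (- H z)" by (rule DERIV_imp_deriv)
      then have "deriv h z * exp (- H z) = deriv u z + deriv H z * u z"
        by (simp add: u_def algebra_simps)
      then have "norm (deriv h z * exp (- H z)) \<le> norm (deriv u z) + norm (deriv H z) * norm (u z)"
        by (metis norm_mult norm_triangle_ineq)
      also have "\<dots> \<le> U * (2 / R) + D * U"
        using du dH U[of z] R D by (intro add_mono mult_mono) (auto simp: D_def)
      finally have "norm (deriv h z) * exp (- \<phi> z) \<le> U * (2 / R + D)"
        by (simp add: norm_mult Hz algebra_simps)
      also have "2 / R + D \<le> (2 / \<delta> * C1 + 1) * D"
      proof -
        have "1 / \<tau> z \<le> C1 * D"
          using C1(2)[of "norm z"] z tau_radial[OF z] radial_deriv_eq[OF z] by (simp add: D_def)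
        then have "2 / \<delta> * (1 / \<tau> z) \<le> 2 / \<delta> * (C1 * D)" using \<delta> by (intro mult_left_mono) auto
        then show ?thesis by (simp add: R_def algebra_simps)
      qed
      finally have "norm (deriv h z) * exp (- \<phi> z) \<le> U * ((2 / \<delta> * C1 + 1) * D)"
        using J0 by (simp add: U_def mult_left_mono)
      then have "norm (deriv h z) * exp (- \<phi> z) * \<tau> z powr \<beta> \<le> U * ((2 / \<delta> * C1 + 1) * D) * \<tau> z powr \<beta>"
        by (rule mult_right_mono) simp
      also have "\<dots> = J * ((\<delta> / 2) powr (- \<beta>) * (2 / \<delta> * C1 + 1)) * D"
      proof -
        have "(R / 2) powr (- \<beta>) * \<tau> z powr \<beta> = (\<delta> / 2) powr (- \<beta>) * (\<tau> z powr (- \<beta>) * \<tau> z powr \<beta>)"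
          using \<delta> t by (simp add: R_def powr_mult[symmetric])
        also have "\<tau> z powr (- \<beta>) * \<tau> z powr \<beta> = 1" using t by (simp add: powr_add[symmetric])
        finally have e: "(R / 2) powr (- \<beta>) * \<tau> z powr \<beta> = (\<delta> / 2) powr (- \<beta>)" by simp
        have "U * ((2 / \<delta> * C1 + 1) * D) * \<tau> z powr \<beta>
            = J * (((R / 2) powr (- \<beta>) * \<tau> z powr \<beta>) * (2 / \<delta> * C1 + 1)) * D"
          by (simp only: U_def mult_ac)
        then show ?thesis unfolding e .
      qed
      finally show ?thesis using D by (simp add: D_def[symmetric] pos_divide_le_eq)
    qed
    moreover have "J * ((\<delta> / 2) powr (- \<beta>) * (2 / \<delta> * C1 + 1))
        \<le> 2 * exp B * \<eta> powr (- \<beta>) * I powr (1 / q) * ((\<delta> / 2) powr (- \<beta>) * (2 / \<delta> * C1 + 1))"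
      using calculation(1) \<delta> C1 by (intro mult_right_mono) auto
    ultimately show "norm (deriv h z) * exp (- \<phi> z) * \<tau> z powr (2 / q) / (1 + radial_deriv \<phi> z) \<le>
        C * (\<integral>\<zeta>. indicator (ball z (\<delta> * \<tau> z)) \<zeta> * (norm (h \<zeta>) powr q * \<omega> \<zeta> powr (q / 2)) \<partial>area) powr (1 / q)"
      by (simp add: C_def \<beta>_def[symmetric] I_def R_def[symmetric] mult_ac)
  qed
qed

section \<open>Symbols of bounded and of compact operators\<close>

lemma bergman_diff:
  assumes q: "q > 0" and f: "f \<in> bergman q \<omega>" and h: "h \<in> bergman q \<omega>"
  shows "(\<lambda>z. f z - h z) \<in> bergman q \<omega>"
proof -
  have hol: "(\<lambda>z. f z - h z) holomorphic_on unit_disk"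
    using f h by (auto simp: bergman_def intro!: holomorphic_intros)
  let ?g = "\<lambda>f z. norm (f z) powr q * \<omega> z powr (q / 2)"
  have int: "integrable area (\<lambda>z. 2 powr q * (?g f z + ?g h z))"
    using f h by (auto simp: bergman_def)
  have "integrable area (?g (\<lambda>z. f z - h z))"
  proof (rule Bochner_Integration.integrable_bound[OF int weighted_power_measurable[OF hol]], rule AE_I2)
    fix z
    let ?m = "max (norm (f z)) (norm (h z))"
    have "norm (f z - h z) \<le> 2 * ?m" using norm_triangle_ineq4[of "f z" "h z"] by linarith
    then have "norm (f z - h z) powr q \<le> (2 * ?m) powr q" using q by (intro powr_mono2) auto
    also have "\<dots> = 2 powr q * ?m powr q" by (simp add: powr_mult)
    also have "?m powr q \<le> norm (f z) powr q + norm (h z) powr q" by (auto simp: max_def)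
    finally have "norm (f z - h z) powr q \<le> 2 powr q * (norm (f z) powr q + norm (h z) powr q)" by simp
    then have "?g (\<lambda>z. f z - h z) z \<le> 2 powr q * (norm (f z) powr q + norm (h z) powr q) * \<omega> z powr (q / 2)"
      by (rule mult_right_mono) simp
    then show "norm (?g (\<lambda>z. f z - h z) z) \<le> norm (2 powr q * (?g f z + ?g h z))"
      by (simp add: algebra_simps)
  qed
  then show ?thesis using hol by (simp add: bergman_def)
qed

text \<open>The expression bounded by \<open>derivative_bounded_by_local_norm\<close>. For \<open>h = S f\<close> with \<open>f\<close> a test function
  it dominates the function that the theorem is about.\<close>
definition weighted_deriv :: "real \<Rightarrow> (complex \<Rightarrow> complex) \<Rightarrow> complex \<Rightarrow> real" where
  "weighted_deriv q h z =
     norm (deriv h z) * exp (- \<phi> z) * \<tau> z powr (2 / q) / (1 + radial_deriv \<phi> z)"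

lemma integrable_indicator_weighted_power:
  assumes "h \<in> bergman q \<omega>" "A \<inter> unit_disk \<in> sets area"
  shows "integrable area (\<lambda>\<zeta>. indicator A \<zeta> * (norm (h \<zeta>) powr q * \<omega> \<zeta> powr (q / 2)))"
proof -
  have "integrable area (\<lambda>\<zeta>. norm (h \<zeta>) powr q * \<omega> \<zeta> powr (q / 2))"
    using assms by (simp add: bergman_def)
  from integrable_mult_indicator[OF assms(2) this]
  have "integrable area (\<lambda>\<zeta>. indicator (A \<inter> unit_disk) \<zeta> * (norm (h \<zeta>) powr q * \<omega> \<zeta> powr (q / 2)))"
    by simp
  then show ?thesis
    by (rule Bochner_Integration.integrable_cong[THEN iffD1, rotated -1]) (auto simp: indicator_def)
qed

lemma sets_area_open: "open A \<Longrightarrow> A \<inter> unit_disk \<in> sets area"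
  by (auto simp: sets_area sets_restrict_space)

lemma weighted_deriv_le_norm:
  assumes q: "q > 0"
  obtains C where "0 < C"
    "\<And>h z. h \<in> bergman q \<omega> \<Longrightarrow> z \<in> unit_disk \<Longrightarrow> weighted_deriv q h z \<le> C * bergman_norm q \<omega> h"
proof -
  obtain \<delta> C where \<delta>: "0 < \<delta>" and C: "0 < C"
    and inside: "\<And>z. z \<in> unit_disk \<Longrightarrow> \<delta> * \<tau> z \<le> (1 - norm z) / 2"
    and loc: "\<And>h z. h \<in> bergman q \<omega> \<Longrightarrow> z \<in> unit_disk \<Longrightarrow>
      norm (deriv h z) * exp (- \<phi> z) * \<tau> z powr (2 / q) / (1 + radial_deriv \<phi> z) \<le>
        C * (\<integral>\<zeta>. indicator (ball z (\<delta> * \<tau> z)) \<zeta> * (norm (h \<zeta>) powr q * \<omega> \<zeta> powr (q / 2)) \<partial>area) powr (1 / q)"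
    using derivative_bounded_by_local_norm[OF q] by blast
  have "weighted_deriv q h z \<le> C * bergman_norm q \<omega> h" if h: "h \<in> bergman q \<omega>" and z: "z \<in> unit_disk" for h z
  proof -
    let ?g = "\<lambda>\<zeta>. norm (h \<zeta>) powr q * \<omega> \<zeta> powr (q / 2)"
    let ?I = "\<integral>\<zeta>. indicator (ball z (\<delta> * \<tau> z)) \<zeta> * ?g \<zeta> \<partial>area"
    have "?I \<le> integral\<^sup>L area ?g"
      using h by (intro integral_mono integrable_indicator_weighted_power sets_area_open)
         (auto simp: bergman_def indicator_def)
    then have "?I powr (1 / q) \<le> bergman_norm q \<omega> h"
      unfolding bergman_norm_def using q by (intro powr_mono2 integral_nonneg_AE) auto
    then have "C * ?I powr (1 / q) \<le> C * bergman_norm q \<omega> h" using C by simp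
    then show ?thesis using loc[OF h z] by (simp add: weighted_deriv_def)
  qed
  then show ?thesis using that C by blast
qed

text \<open>The disks of radius \<open>\<delta> \<tau>(z) \<le> (1 - \<bar>z\<bar>)/2\<close> lie in thin boundary annuli, over which the integral of
  a fixed integrable function is small.\<close>
lemma weighted_deriv_vanishes:
  assumes q: "q > 0" and h: "h \<in> bergman q \<omega>" and \<epsilon>: "\<epsilon> > 0"
  shows "\<exists>r<1. \<forall>z\<in>unit_disk. r < norm z \<longrightarrow> weighted_deriv q h z < \<epsilon>"
proof -
  obtain \<delta> C where \<delta>: "0 < \<delta>" and C: "0 < C"
    and inside: "\<And>z. z \<in> unit_disk \<Longrightarrow> \<delta> * \<tau> z \<le> (1 - norm z) / 2"
    and loc: "\<And>h z. h \<in> bergman q \<omega> \<Longrightarrow> z \<in> unit_disk \<Longrightarrow>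
      norm (deriv h z) * exp (- \<phi> z) * \<tau> z powr (2 / q) / (1 + radial_deriv \<phi> z) \<le>
        C * (\<integral>\<zeta>. indicator (ball z (\<delta> * \<tau> z)) \<zeta> * (norm (h \<zeta>) powr q * \<omega> \<zeta> powr (q / 2)) \<partial>area) powr (1 / q)"
    using derivative_bounded_by_local_norm[OF q] by blast
  let ?g = "\<lambda>\<zeta>. norm (h \<zeta>) powr q * \<omega> \<zeta> powr (q / 2)"
  define \<rho> where "\<rho> = (\<lambda>n. 1 - 1 / real (Suc n))"
  define A where "A = (\<lambda>n. - cball (0::complex) (\<rho> n))"
  have Aopen: "open (A n)" for n by (simp add: A_def open_Compl)
  note intA = integrable_indicator_weighted_power[OF h sets_area_open[OF Aopen]]
  have int: "integrable area ?g" using h by (simp add: bergman_def)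
  have \<rho>1: "\<rho> n < 1" for n by (simp add: \<rho>_def)
  have \<rho>lim: "\<rho> \<longlonglongrightarrow> 1"
    unfolding \<rho>_def using tendsto_diff[OF tendsto_const[of 1] LIMSEQ_inverse_real_of_nat]
    by (simp add: divide_inverse)
  have "(\<lambda>n. \<integral>\<zeta>. indicator (A n) \<zeta> * ?g \<zeta> \<partial>area) \<longlonglongrightarrow> (\<integral>\<zeta>. 0 \<partial>area)"
  proof (rule integral_dominated_convergence[where w = ?g])
    show "AE \<zeta> in area. (\<lambda>n. indicator (A n) \<zeta> * ?g \<zeta>) \<longlonglongrightarrow> 0"
    proof (rule AE_I2)
      fix \<zeta> assume "\<zeta> \<in> space area"
      then have "norm \<zeta> < 1" by simp
      then have "\<forall>\<^sub>F n in sequentially. norm \<zeta> < \<rho> n" using \<rho>lim by (intro order_tendstoD)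
      then have "\<forall>\<^sub>F n in sequentially. indicator (A n) \<zeta> * ?g \<zeta> = 0"
        by eventually_elim (auto simp: A_def indicator_def)
      then show "(\<lambda>n. indicator (A n) \<zeta> * ?g \<zeta>) \<longlonglongrightarrow> 0" by (rule tendsto_eventually)
    qed
    show "AE \<zeta> in area. norm (indicator (A n) \<zeta> * ?g \<zeta>) \<le> ?g \<zeta>" for n
      by (rule AE_I2) (auto simp: indicator_def abs_mult)
  qed (use int intA in auto)
  then have "(\<lambda>n. (\<integral>\<zeta>. indicator (A n) \<zeta> * ?g \<zeta> \<partial>area)) \<longlonglongrightarrow> 0" by simp
  moreover have "(\<epsilon> / (2 * C)) powr q > 0" using C \<epsilon> by simp
  ultimately have "\<forall>\<^sub>F n in sequentially. (\<integral>\<zeta>. indicator (A n) \<zeta> * ?g \<zeta> \<partial>area) < (\<epsilon> / (2 * C)) powr q"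
    by (rule order_tendstoD)
  then obtain n where n: "(\<integral>\<zeta>. indicator (A n) \<zeta> * ?g \<zeta> \<partial>area) < (\<epsilon> / (2 * C)) powr q"
    using eventually_happens'[OF sequentially_bot] by blast
  \<comment> \<open>\<open>\<bar>z\<bar> > (1 + 2 \<rho>)/3\<close> is equivalent to \<open>\<bar>z\<bar> - (1 - \<bar>z\<bar>)/2 > \<rho>\<close>.\<close>
  have "weighted_deriv q h z < \<epsilon>" if z: "z \<in> unit_disk" and far: "(1 + 2 * \<rho> n) / 3 < norm z" for z
  proof -
    let ?I = "\<integral>\<zeta>. indicator (ball z (\<delta> * \<tau> z)) \<zeta> * ?g \<zeta> \<partial>area"
    have sub: "ball z (\<delta> * \<tau> z) \<subseteq> A n"
    proof
      fix \<zeta> assume "\<zeta> \<in> ball z (\<delta> * \<tau> z)"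
      then have "norm (z - \<zeta>) < (1 - norm z) / 2" using inside[OF z] by (simp add: dist_norm)
      moreover have "norm z \<le> norm \<zeta> + norm (z - \<zeta>)" using norm_triangle_sub[of z \<zeta>] .
      moreover have "1 + 2 * \<rho> n < 3 * norm z" using far by (simp add: field_simps)
      ultimately have "\<rho> n < norm \<zeta>" by argo
      then show "\<zeta> \<in> A n" by (simp add: A_def)
    qed
    have "?I \<le> (\<integral>\<zeta>. indicator (A n) \<zeta> * ?g \<zeta> \<partial>area)"
    proof (rule integral_mono)
      fix \<zeta>
      show "indicator (ball z (\<delta> * \<tau> z)) \<zeta> * ?g \<zeta> \<le> indicator (A n) \<zeta> * ?g \<zeta>"
        using sub by (intro mult_right_mono) (auto simp: indicator_def)
    qed (use h Aopen in \<open>auto intro!: integrable_indicator_weighted_power sets_area_open\<close>)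
    then have "?I \<le> (\<epsilon> / (2 * C)) powr q" using n by simp
    then have "?I powr (1 / q) \<le> ((\<epsilon> / (2 * C)) powr q) powr (1 / q)"
      using q by (intro powr_mono2 integral_nonneg_AE) auto
    also have "\<dots> = \<epsilon> / (2 * C)" using q \<epsilon> C by (simp add: powr_powr)
    finally have "C * ?I powr (1 / q) \<le> C * (\<epsilon> / (2 * C))" using C by (intro mult_left_mono) auto
    also have "\<dots> < \<epsilon>" using C \<epsilon> by simp
    finally show ?thesis using loc[OF h z] by (simp add: weighted_deriv_def)
  qed
  moreover have "(1 + 2 * \<rho> n) / 3 < 1" using \<rho>1[of n] by simp
  ultimately show ?thesis by blast
qed

lemma symbol_bounded:
  assumes q: "q > 0" and S: "bounded_op p q \<omega> S"
    and test: "\<And>z. z \<in> unit_disk \<Longrightarrow>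
      \<exists>f\<in>bergman p \<omega>. bergman_norm p \<omega> f \<le> M \<and> W z \<le> weighted_deriv q (S f) z"
  shows "\<exists>B. \<forall>z\<in>unit_disk. W z \<le> B"
proof -
  obtain C where C: "0 < C"
    "\<And>h z. h \<in> bergman q \<omega> \<Longrightarrow> z \<in> unit_disk \<Longrightarrow> weighted_deriv q h z \<le> C * bergman_norm q \<omega> h"
    using weighted_deriv_le_norm[OF q] by blast
  obtain K where K: "\<And>f. f \<in> bergman p \<omega> \<Longrightarrow> bergman_norm q \<omega> (S f) \<le> K * bergman_norm p \<omega> f"
    and maps: "\<And>f. f \<in> bergman p \<omega> \<Longrightarrow> S f \<in> bergman q \<omega>"
    using S by (auto simp: bounded_op_def)
  have "W z \<le> C * (\<bar>K\<bar> * M)" if z: "z \<in> unit_disk" for z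
  proof -
    obtain f where f: "f \<in> bergman p \<omega>" "bergman_norm p \<omega> f \<le> M" "W z \<le> weighted_deriv q (S f) z"
      using test[OF z] by blast
    have nn: "bergman_norm p \<omega> f \<ge> 0" by (simp add: bergman_norm_def)
    have "weighted_deriv q (S f) z \<le> C * bergman_norm q \<omega> (S f)" by (rule C(2)[OF maps[OF f(1)] z])
    also have "bergman_norm q \<omega> (S f) \<le> \<bar>K\<bar> * bergman_norm p \<omega> f"
      using K[OF f(1)] nn by (meson abs_ge_self mult_right_mono order_trans)
    also have "\<dots> \<le> \<bar>K\<bar> * M" using f by (intro mult_left_mono) auto
    finally show ?thesis using f C by simp
  qed
  then show ?thesis by blast
qed

text \<open>If \<open>W\<close> stayed above \<open>\<epsilon>\<close> along \<open>z\<^sub>n\<close> approaching the boundary, so would the weighted derivatives of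
  the images of the test functions. A subsequence of the images converges to some \<open>h\<close>: the
  weighted derivative of the difference is small uniformly, that of \<open>h\<close> is small near the boundary.\<close>
lemma symbol_vanishes:
  assumes q: "q > 0" and S: "compact_op p q \<omega> S"
    and test: "\<And>z. z \<in> unit_disk \<Longrightarrow>
      \<exists>f\<in>bergman p \<omega>. bergman_norm p \<omega> f \<le> M \<and> W z \<le> weighted_deriv q (S f) z"
    and \<epsilon>: "\<epsilon> > 0"
  shows "\<exists>r<1. \<forall>z\<in>unit_disk. r < norm z \<longrightarrow> W z < \<epsilon>"
proof (rule ccontr)
  assume contra: "\<not> ?thesis"
  have "\<exists>z f. z \<in> unit_disk \<and> 1 - 1 / real (Suc n) < norm z \<and> \<epsilon> \<le> weighted_deriv q (S f) z \<and>
      f \<in> bergman p \<omega> \<and> bergman_norm p \<omega> f \<le> M" for n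
  proof -
    have "1 - 1 / real (Suc n) < 1" by simp
    then obtain z where z: "z \<in> unit_disk" "1 - 1 / real (Suc n) < norm z" "\<epsilon> \<le> W z"
      using contra by (meson not_le)
    then show ?thesis using test[OF z(1)] by (meson order_trans)
  qed
  then obtain Z F where Z: "\<And>n. Z n \<in> unit_disk" "\<And>n. 1 - 1 / real (Suc n) < norm (Z n)"
    and large: "\<And>n. \<epsilon> \<le> weighted_deriv q (S (F n)) (Z n)"
    and F: "\<And>n. F n \<in> bergman p \<omega>" "\<And>n. bergman_norm p \<omega> (F n) \<le> M"
    by metis
  have maps: "\<And>f. f \<in> bergman p \<omega> \<Longrightarrow> S f \<in> bergman q \<omega>"
    using S by (auto simp: compact_op_def)
  obtain h s where h: "h \<in> bergman q \<omega>" and s: "strict_mono (s :: nat \<Rightarrow> nat)"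
    and conv: "(\<lambda>n. bergman_norm q \<omega> (\<lambda>z. S (F (s n)) z - h z)) \<longlonglongrightarrow> 0"
    using S F unfolding compact_op_def by blast
  obtain C where C: "0 < C"
    "\<And>h z. h \<in> bergman q \<omega> \<Longrightarrow> z \<in> unit_disk \<Longrightarrow> weighted_deriv q h z \<le> C * bergman_norm q \<omega> h"
    using weighted_deriv_le_norm[OF q] by blast
  obtain r where r: "r < 1" "\<And>z. z \<in> unit_disk \<Longrightarrow> r < norm z \<Longrightarrow> weighted_deriv q h z < \<epsilon> / 2"
    using weighted_deriv_vanishes[OF q h, of "\<epsilon> / 2"] \<epsilon> by auto
  have "\<forall>\<^sub>F n in sequentially. bergman_norm q \<omega> (\<lambda>z. S (F (s n)) z - h z) < \<epsilon> / (2 * C)"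
    using conv C \<epsilon> by (intro order_tendstoD) auto
  moreover have "(\<lambda>n. 1 - 1 / real (Suc n)) \<longlonglongrightarrow> 1"
    using tendsto_diff[OF tendsto_const[of 1] LIMSEQ_inverse_real_of_nat] by (simp add: divide_inverse)
  then have "\<forall>\<^sub>F n in sequentially. r < 1 - 1 / real (Suc n)" using r by (intro order_tendstoD)
  ultimately have "\<forall>\<^sub>F n in sequentially. bergman_norm q \<omega> (\<lambda>z. S (F (s n)) z - h z) < \<epsilon> / (2 * C)
      \<and> r < 1 - 1 / real (Suc n)" by (rule eventually_conj)
  then obtain n where n: "bergman_norm q \<omega> (\<lambda>z. S (F (s n)) z - h z) < \<epsilon> / (2 * C)"
      "r < 1 - 1 / real (Suc n)"
    using eventually_happens'[OF sequentially_bot] by blast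
  define z k where "z = Z (s n)" and "k = (\<lambda>z. S (F (s n)) z - h z)"
  have z: "z \<in> unit_disk" using Z by (simp add: z_def)
  have "1 - 1 / real (Suc n) \<le> 1 - 1 / real (Suc (s n))"
    using seq_suble[OF s, of n] by (simp add: frac_le)
  then have far: "r < norm z" using n(2) Z(2)[of "s n"] by (simp add: z_def)
  have k: "k \<in> bergman q \<omega>" unfolding k_def using maps F h by (intro bergman_diff q) auto
  have "k holomorphic_on unit_disk" "h holomorphic_on unit_disk"
    using k h by (auto simp: bergman_def)
  then have "k field_differentiable at z" "h field_differentiable at z"
    using z by (auto intro: holomorphic_on_imp_differentiable_at)
  then have "deriv (\<lambda>z. k z + h z) z = deriv k z + deriv h z" by (rule deriv_add)
  then have "deriv (S (F (s n))) z = deriv k z + deriv h z" by (simp add: k_def)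
  then have "norm (deriv (S (F (s n))) z) \<le> norm (deriv k z) + norm (deriv h z)"
    by (simp add: norm_triangle_ineq)
  moreover have "exp (- \<phi> z) * \<tau> z powr (2 / q) / (1 + radial_deriv \<phi> z) \<ge> 0"
    using radial_deriv_nonneg[OF z] by simp
  ultimately have "norm (deriv (S (F (s n))) z) * (exp (- \<phi> z) * \<tau> z powr (2 / q) / (1 + radial_deriv \<phi> z))
      \<le> (norm (deriv k z) + norm (deriv h z)) * (exp (- \<phi> z) * \<tau> z powr (2 / q) / (1 + radial_deriv \<phi> z))"
    by (rule mult_right_mono)
  then have "weighted_deriv q (S (F (s n))) z \<le> weighted_deriv q k z + weighted_deriv q h z"
    by (simp add: weighted_deriv_def distrib_right add_divide_distrib mult.assoc)
  also have "weighted_deriv q k z \<le> C * bergman_norm q \<omega> k" by (rule C(2)[OF k z])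
  also have "\<dots> < C * (\<epsilon> / (2 * C))" using n(1) C unfolding k_def by (intro mult_strict_left_mono)
  also have "\<dots> = \<epsilon> / 2" using C by simp
  finally have "weighted_deriv q (S (F (s n))) z < \<epsilon> / 2 + weighted_deriv q h z" by simp
  then show False using r(2)[OF z far] large[of "s n"] by (simp add: z_def)
qed

section \<open>Measurability of the data\<close>

lemma radial_deriv_continuous: "continuous_on unit_disk (radial_deriv \<phi>)"
proof -
  have "continuous_on unit_disk (dx \<phi>)" using C1_phi(1) by (simp add: C1_on_def)
  then have "continuous_on unit_disk (\<lambda>z. \<Phi>' (norm z))"
    by (rule continuous_on_compose2[where f = "\<lambda>z. of_real (norm z)"]) (auto intro!: continuous_intros)
  then show ?thesis by (rule continuous_on_eq) (rule radial_deriv_eq[symmetric])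
qed

text \<open>By monotonicity of the profile: \<open>\<tau>\<close> may jump at the origin.\<close>
lemma tau_measurable: "\<tau> \<in> borel_measurable area"
proof -
  have "mono_on {0..<1} (\<lambda>r. - T r)"
    by (rule mono_onI) (use T_antimono in auto)
  then have m: "(\<lambda>r. - T r) \<in> borel_measurable (restrict_space borel {0..<1})"
    by (rule borel_measurable_mono_on_fnc)
  have "norm \<in> borel_measurable area"
    by (intro borel_measurable_area_continuous continuous_intros)
  then have "norm \<in> area \<rightarrow>\<^sub>M restrict_space borel {0..<1}"
    by (intro measurable_restrict_space2) auto
  from measurable_compose[OF this m] have "(\<lambda>z. - T (norm z)) \<in> borel_measurable area" .
  then have "(\<lambda>z. - (- T (norm z))) \<in> borel_measurable area" by (rule borel_measurable_uminus)
  then show ?thesis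
    by (rule measurable_cong[THEN iffD2, rotated]) (simp only: minus_minus space_area, rule tau_radial)
qed

lemma omega_measurable: "\<omega> \<in> borel_measurable area"
proof -
  have "(\<lambda>z. exp (- 2 * \<phi> z)) \<in> borel_measurable area"
    by (intro borel_measurable_area_continuous continuous_intros phi_continuous)
  then show ?thesis
    by (rule measurable_cong[THEN iffD2, rotated]) (simp only: space_area, rule omega_eq)
qed

lemma radial_deriv_measurable: "radial_deriv \<phi> \<in> borel_measurable area"
  by (rule borel_measurable_area_continuous[OF radial_deriv_continuous])

end

section \<open>Necessary conditions for boundedness and compactness\<close>

theorem proposition1p3:
  fixes \<omega> \<phi> \<tau> :: "complex \<Rightarrow> real" and \<psi> g :: "complex \<Rightarrow> complex"
  assumes "class_W \<omega> \<phi> \<tau>"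
    and "\<psi> holomorphic_on unit_disk" and "\<psi> ` unit_disk \<subseteq> unit_disk"
    and "g holomorphic_on unit_disk"
  shows "(\<forall>p q :: real. 0 < p \<and> 0 < q \<longrightarrow>
     (let F = (\<lambda>z. norm (g z) * (\<tau> z powr (2 / q) / \<tau> (\<psi> z) powr (2 / p)) *
                ((1 + radial_deriv \<phi> (\<psi> z)) / (1 + radial_deriv \<phi> z)) *
                (\<omega> z powr (1 / 2) / \<omega> (\<psi> z) powr (1 / 2)))
      in (bounded_op p q \<omega> (GI \<psi> g) \<longrightarrow> F \<in> L_infinity area) \<and>
         (compact_op p q \<omega> (GI \<psi> g) \<longrightarrow> (F \<longlongrightarrow> 0) (to_boundary (\<lambda>z. z))))) \<and>
   (\<forall>p q :: real. 0 < p \<and> p \<le> q \<longrightarrow>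
     (let F = (\<lambda>z. (\<tau> z powr (2 / q) / \<tau> (\<psi> z) powr (2 / p)) *
                (norm (g z) / (1 + radial_deriv \<phi> z)) *
                (\<omega> z powr (1 / 2) / \<omega> (\<psi> z) powr (1 / 2)))
      in (bounded_op p q \<omega> (GV \<psi> g) \<longrightarrow> F \<in> L_infinity area) \<and>
         (compact_op p q \<omega> (GV \<psi> g) \<longrightarrow> (F \<longlongrightarrow> 0) (to_boundary \<psi>))))"
proof -
  interpret rapid_weight \<omega> \<phi> \<tau> by standard (rule assms(1))
  note \<psi> = assms(2,3) and g = assms(4)
  have \<psi>z: "\<psi> z \<in> unit_disk" if "z \<in> unit_disk" for z using \<psi>(2) that by blast
  note [measurable] = tau_measurable omega_measurable radial_deriv_measurable self_map_measurable[OF \<psi>]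
  have [measurable]: "g \<in> borel_measurable area"
    by (intro borel_measurable_area_continuous holomorphic_on_imp_continuous_on g)
  have half: "\<omega> z powr (1 / 2) = exp (- \<phi> z)" if "z \<in> unit_disk" for z
    using omega_eq[OF that] by (simp add: powr_def)
  have omega_quotient: "\<omega> z powr (1 / 2) / \<omega> (\<psi> z) powr (1 / 2) = exp (\<phi> (\<psi> z)) * exp (- \<phi> z)"
    if "z \<in> unit_disk" for z
    unfolding half[OF that] half[OF \<psi>z[OF that]] exp_minus[of "\<phi> (\<psi> z)"]
    by (simp only: divide_inverse inverse_inverse_eq mult.commute)
  have tau_quotient: "\<tau> z powr (2 / q) / \<tau> (\<psi> z) powr (2 / p) = \<tau> z powr (2 / q) * \<tau> (\<psi> z) powr (- 2 / p)"
    for z p q by (simp add: powr_minus divide_inverse)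
  have conclusion: "(bounded_op p q \<omega> S \<longrightarrow> F \<in> L_infinity area) \<and>
      (compact_op p q \<omega> S \<longrightarrow> (F \<longlongrightarrow> 0) (to_boundary (\<lambda>z. z)) \<and> (F \<longlongrightarrow> 0) (to_boundary \<psi>))"
    if q: "q > 0" and meas: "F \<in> borel_measurable area"
      and nonneg: "\<And>z. z \<in> unit_disk \<Longrightarrow> F z \<ge> 0"
      and test: "\<And>z. z \<in> unit_disk \<Longrightarrow>
        \<exists>f\<in>bergman p \<omega>. bergman_norm p \<omega> f \<le> M \<and> F z \<le> weighted_deriv q (S f) z"
    for p q M F S
  proof (intro conjI impI)
    assume "bounded_op p q \<omega> S"
    then obtain B where "\<forall>z\<in>unit_disk. F z \<le> B"
      using symbol_bounded[where W = F, OF q _ test] by blast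
    then have "AE z in area. \<bar>F z\<bar> \<le> B" using nonneg by (intro AE_I2) auto
    then show "F \<in> L_infinity area" using meas by (auto simp: L_infinity_def)
  next
    assume "compact_op p q \<omega> S"
    then have "\<exists>r<1. \<forall>z\<in>unit_disk. r < norm z \<longrightarrow> F z < \<epsilon>" if "\<epsilon> > 0" for \<epsilon>
      using symbol_vanishes[where W = F, OF q _ test that] by blast
    then have "\<exists>r<1. \<forall>z\<in>unit_disk. r < norm z \<longrightarrow> \<bar>F z\<bar> < \<epsilon>" if "\<epsilon> > 0" for \<epsilon>
      using that nonneg by (metis abs_of_nonneg)
    note tendsto_to_boundary_self_map[OF _ _ this]
    then show "(F \<longlongrightarrow> 0) (to_boundary (\<lambda>z. z))" "(F \<longlongrightarrow> 0) (to_boundary \<psi>)"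
      using \<psi> by auto
  qed
  show ?thesis
    unfolding Let_def
  proof (intro conjI allI impI; (elim conjE)?)
    fix p q :: real assume p: "0 < p" and q: "0 < q"
    let ?F = "\<lambda>z. norm (g z) * (\<tau> z powr (2 / q) / \<tau> (\<psi> z) powr (2 / p)) *
                ((1 + radial_deriv \<phi> (\<psi> z)) / (1 + radial_deriv \<phi> z)) *
                (\<omega> z powr (1 / 2) / \<omega> (\<psi> z) powr (1 / 2))"
    obtain M where height: "\<And>a. a \<in> unit_disk \<Longrightarrow> \<exists>f\<in>bergman p \<omega>. bergman_norm p \<omega> f \<le> M \<and>
       exp (\<phi> a) * \<tau> a powr (- 2 / p) \<le> norm (f a)"
      and M: "\<And>a. a \<in> unit_disk \<Longrightarrow> \<exists>f\<in>bergman p \<omega>. bergman_norm p \<omega> f \<le> M \<and>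
       exp (\<phi> a) * \<tau> a powr (- 2 / p) * (1 + radial_deriv \<phi> a) \<le> norm (deriv f a)"
      using test_functions[OF p] by blast
    have test: "\<exists>f\<in>bergman p \<omega>. bergman_norm p \<omega> f \<le> M \<and> ?F z \<le> weighted_deriv q (GI \<psi> g f) z"
      if z: "z \<in> unit_disk" for z
    proof -
      obtain f where f: "f \<in> bergman p \<omega>" "bergman_norm p \<omega> f \<le> M"
        and low: "exp (\<phi> (\<psi> z)) * \<tau> (\<psi> z) powr (- 2 / p) * (1 + radial_deriv \<phi> (\<psi> z)) \<le> norm (deriv f (\<psi> z))"
        using M[OF \<psi>z[OF z]] by blast
      have "f holomorphic_on unit_disk" using f by (simp add: bergman_def)
      from deriv_GI[OF this \<psi> g z]
      have d: "deriv (GI \<psi> g f) z = deriv f (\<psi> z) * g z" .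
      let ?c = "norm (g z) * exp (- \<phi> z) * \<tau> z powr (2 / q) / (1 + radial_deriv \<phi> z)"
      have "?F z = exp (\<phi> (\<psi> z)) * \<tau> (\<psi> z) powr (- 2 / p) * (1 + radial_deriv \<phi> (\<psi> z)) * ?c"
        unfolding omega_quotient[OF z] tau_quotient by (simp add: divide_inverse mult_ac)
      also have "\<dots> \<le> norm (deriv f (\<psi> z)) * ?c"
        using low radial_deriv_nonneg[OF z] by (intro mult_right_mono) auto
      also have "\<dots> = weighted_deriv q (GI \<psi> g f) z"
        unfolding weighted_deriv_def d by (simp add: norm_mult mult_ac)
      finally show ?thesis using f by blast
    qed
    have nonneg: "?F z \<ge> 0" if "z \<in> unit_disk" for z
      using radial_deriv_nonneg[OF that] radial_deriv_nonneg[OF \<psi>z[OF that]] by simp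
    have meas: "?F \<in> borel_measurable area" by measurable
    note * = conclusion[of q ?F p M "GI \<psi> g", OF q meas nonneg test]
    show "?F \<in> L_infinity area" if "bounded_op p q \<omega> (GI \<psi> g)" using * that by blast
    show "(?F \<longlongrightarrow> 0) (to_boundary (\<lambda>z. z))" if "compact_op p q \<omega> (GI \<psi> g)" using * that by blast
  next
    fix p q :: real assume p: "0 < p" and "p \<le> q"
    then have q: "0 < q" by simp
    let ?F = "\<lambda>z. (\<tau> z powr (2 / q) / \<tau> (\<psi> z) powr (2 / p)) *
                (norm (g z) / (1 + radial_deriv \<phi> z)) *
                (\<omega> z powr (1 / 2) / \<omega> (\<psi> z) powr (1 / 2))"
    obtain M where M: "\<And>a. a \<in> unit_disk \<Longrightarrow> \<exists>f\<in>bergman p \<omega>. bergman_norm p \<omega> f \<le> M \<and>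
       exp (\<phi> a) * \<tau> a powr (- 2 / p) \<le> norm (f a)"
      and slope: "\<And>a. a \<in> unit_disk \<Longrightarrow> \<exists>f\<in>bergman p \<omega>. bergman_norm p \<omega> f \<le> M \<and>
       exp (\<phi> a) * \<tau> a powr (- 2 / p) * (1 + radial_deriv \<phi> a) \<le> norm (deriv f a)"
      using test_functions[OF p] by blast
    have test: "\<exists>f\<in>bergman p \<omega>. bergman_norm p \<omega> f \<le> M \<and> ?F z \<le> weighted_deriv q (GV \<psi> g f) z"
      if z: "z \<in> unit_disk" for z
    proof -
      obtain f where f: "f \<in> bergman p \<omega>" "bergman_norm p \<omega> f \<le> M"
        and low: "exp (\<phi> (\<psi> z)) * \<tau> (\<psi> z) powr (- 2 / p) \<le> norm (f (\<psi> z))"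
        using M[OF \<psi>z[OF z]] by blast
      have "f holomorphic_on unit_disk" using f by (simp add: bergman_def)
      from deriv_GV[OF this \<psi> g z]
      have d: "deriv (GV \<psi> g f) z = f (\<psi> z) * g z" .
      let ?c = "norm (g z) * exp (- \<phi> z) * \<tau> z powr (2 / q) / (1 + radial_deriv \<phi> z)"
      have "?F z = exp (\<phi> (\<psi> z)) * \<tau> (\<psi> z) powr (- 2 / p) * ?c"
        unfolding omega_quotient[OF z] tau_quotient by (simp add: divide_inverse mult_ac)
      also have "\<dots> \<le> norm (f (\<psi> z)) * ?c"
        using low radial_deriv_nonneg[OF z] by (intro mult_right_mono) auto
      also have "\<dots> = weighted_deriv q (GV \<psi> g f) z"
        unfolding weighted_deriv_def d by (simp add: norm_mult mult_ac)
      finally show ?thesis using f by blast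
    qed
    have nonneg: "?F z \<ge> 0" if "z \<in> unit_disk" for z
      using radial_deriv_nonneg[OF that] by simp
    have meas: "?F \<in> borel_measurable area" by measurable
    note * = conclusion[of q ?F p M "GV \<psi> g", OF q meas nonneg test]
    show "?F \<in> L_infinity area" if "bounded_op p q \<omega> (GV \<psi> g)" using * that by blast
    show "(?F \<longlongrightarrow> 0) (to_boundary \<psi>)" if "compact_op p q \<omega> (GV \<psi> g)" using * that by blast
  qed
qed

end
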